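(* There exists a correct tiling of the plane by square tiles, and every correct tiling of the plane by square tiles is non-periodic, i.e. there is no nonzero vector $a$ such that translating the tiling by $a$ (together with all its colors and orientations) yields the same tiling.
   Context: Colors are red and green. An arrow is a segment carrying an orientation (one of its two directions) and a color. A square tile is a unit square divided by its two diagonals into four isosceles right triangles (with right angles at the center of the square), each triangle colored red or green, decorated as follows: each of the four sides of the square is an arrow (arbitrary orientation and color); one diagonal, called the axis of the tile, is a single arrow of one color going from a corner to the opposite corner; the two halves of the other diagonal are arrows pointing from their corners towards the center, one red and one green; for each of these two half-diagonal arrows, the triangle immediately to its left (as seen by someone moving along it towards the center) is red and the triangle immediately to its right is green. The set of tiles is closed under rotations by multiples of $90^\circ$ but tiles may not be reflected (there are $4096$ tiles up to translation). A correct tiling by square tiles is a covering of the whole plane by translated copies of such tiles with pairwise disjoint interiors satisfying: (1) tiles meet side to side (edge-to-edge), and shared sides have the same color and orientation in both tiles; (2) any two triangles (of the same or of adjacent tiles) sharing a side have different colors; (3) at every vertex $v$ of the tiling, the crossing at $v$ (the set of arrows — square sides and half-diagonals, the axis being regarded as two half-diagonal arrows with its color and orientation — that have $v$ as an endpoint, each entering or leaving $v$) is legal. A crossing is legal if it consists of eight arrows at consecutive angles of $45^\circ$ such that: two collinear arrows of the same color pass through $v$ in the same direction (one entering and one leaving $v$), forming the axis of the crossing; the two arrows perpendicular to the axis both enter $v$ and have different colors; the remaining four arrows (at $45^\circ$ to the axis) leave $v$; and for each of the two perpendicular entering arrows, of the two leaving arrows forming a $45^\circ$ angle with it, the one on the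 left (as seen by someone moving along the entering arrow towards $v$) is red and the one on the right is green. *)

theory Defs
  imports "HOL-Analysis.Analysis"
begin

text \<open>The plane is the type of complex numbers, so that multiplication by \<^term>\<open>\<i>\<close> is the
  counterclockwise rotation by a right angle.\<close>

datatype color = Red | Green

datatype arrow = Arrow (tail: complex) (head: complex) (hue: color)

definition support :: "arrow \<Rightarrow> complex set" where
  "support \<alpha> = closed_segment (tail \<alpha>) (head \<alpha>)"

text \<open>The corners \<open>0, 1, 2, 3\<close> of the unit square with centre \<open>z\<close> are the north-east, north-west,
  south-west and south-east ones; the index is periodic with period \<open>4\<close>.\<close>

definition corner :: "complex \<Rightarrow> nat \<Rightarrow> complex" where
  "corner z j = z + \<i> ^ j * Complex (1/2) (1/2)"

definition square :: "complex \<Rightarrow> complex set" where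
  "square z = cbox (corner z 2) (corner z 0)"

definition edge :: "complex \<Rightarrow> nat \<Rightarrow> complex set" where
  "edge z j = closed_segment (corner z j) (corner z (Suc j))"

text \<open>A triangle is given by the set of its three vertices.  The triangle \<open>j\<close> of a square lies
  between the half-diagonals from the corners \<open>j\<close> and \<open>Suc j\<close>.\<close>

definition triangle :: "complex \<Rightarrow> nat \<Rightarrow> complex set" where
  "triangle z j = {z, corner z j, corner z (Suc j)}"

record tile =
  center :: complex
  sides :: "arrow set"
  axis :: arrow
  half_diagonals :: "arrow set"
  triangles :: "(complex set \<times> color) set"

text \<open>The axis goes from the corner \<open>a\<close> to the corner \<open>a + 2\<close>.  For someone moving from the corner
  \<open>j\<close> to the centre, the triangle \<open>j - 1\<close> is on the left and the triangle \<open>j\<close> on the right.\<close>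

definition square_tile :: "tile \<Rightarrow> bool" where
  "square_tile t \<longleftrightarrow>
    (\<exists>z s a c h\<^sub>1 h\<^sub>2 col.
      center t = z \<and>
      sides t = s ` {..<4} \<and>
      (\<forall>j<4. (tail (s j), head (s j)) \<in>
         {(corner z j, corner z (Suc j)), (corner z (Suc j), corner z j)}) \<and>
      axis t = Arrow (corner z a) (corner z (a + 2)) c \<and>
      half_diagonals t = {Arrow (corner z (a + 1)) z h\<^sub>1, Arrow (corner z (a + 3)) z h\<^sub>2} \<and>
      h\<^sub>1 \<noteq> h\<^sub>2 \<and>
      triangles t = (\<lambda>j. (triangle z j, col j)) ` {a..<a + 4} \<and>
      (\<forall>j\<in>{a + 1, a + 3}. col (j - 1) = Red \<and> col j = Green))"

definition translate_arrow :: "complex \<Rightarrow> arrow \<Rightarrow> arrow" where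
  "translate_arrow v \<alpha> = Arrow (tail \<alpha> + v) (head \<alpha> + v) (hue \<alpha>)"

definition translate_tile :: "complex \<Rightarrow> tile \<Rightarrow> tile" where
  "translate_tile v t =
    \<lparr>center = center t + v,
     sides = translate_arrow v ` sides t,
     axis = translate_arrow v (axis t),
     half_diagonals = translate_arrow v ` half_diagonals t,
     triangles = (\<lambda>(X, c). ((\<lambda>x. x + v) ` X, c)) ` triangles t\<rparr>"

definition tile_arrows :: "tile \<Rightarrow> arrow set" where
  "tile_arrows t = sides t \<union> half_diagonals t \<union>
    {Arrow (tail (axis t)) (center t) (hue (axis t)),
     Arrow (center t) (head (axis t)) (hue (axis t))}"

definition crossing :: "tile set \<Rightarrow> complex \<Rightarrow> arrow set" where
  "crossing T v = {\<alpha> \<in> (\<Union>t\<in>T. tile_arrows t). tail \<alpha> = v \<or> head \<alpha> = v}"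

text \<open>The unit vector \<open>d\<close> is the direction from \<open>v\<close> to the other endpoint of the arrow, also for an
  entering arrow.\<close>

definition leaves :: "complex \<Rightarrow> complex \<Rightarrow> arrow \<Rightarrow> bool" where
  "leaves v d \<alpha> \<longleftrightarrow> tail \<alpha> = v \<and> sgn (head \<alpha> - v) = d"

definition enters :: "complex \<Rightarrow> complex \<Rightarrow> arrow \<Rightarrow> bool" where
  "enters v d \<alpha> \<longleftrightarrow> head \<alpha> = v \<and> sgn (tail \<alpha> - v) = d"

text \<open>The arrows at \<open>v\<close> are numbered counterclockwise, starting with the outgoing arrow of the axis.
  For someone entering \<open>v\<close> along the arrow \<open>k\<close>, the arrow \<open>k - 1\<close> is on the left and the arrow
  \<open>k + 1\<close> on the right.\<close>

definition legal_crossing :: "complex \<Rightarrow> arrow set \<Rightarrow> bool" where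
  "legal_crossing v A \<longleftrightarrow>
    (\<exists>(u::complex) d (\<alpha> :: nat \<Rightarrow> arrow).
      norm u = 1 \<and> (\<forall>k. d k = u * cis (real k * pi / 4)) \<and>
      A = \<alpha> ` {..<8} \<and>
      leaves v (d 0) (\<alpha> 0) \<and> enters v (d 4) (\<alpha> 4) \<and> hue (\<alpha> 0) = hue (\<alpha> 4) \<and>
      enters v (d 2) (\<alpha> 2) \<and> enters v (d 6) (\<alpha> 6) \<and> hue (\<alpha> 2) \<noteq> hue (\<alpha> 6) \<and>
      (\<forall>k\<in>{1, 3, 5, 7}. leaves v (d k) (\<alpha> k)) \<and>
      (\<forall>k\<in>{2, 6}. hue (\<alpha> (k - 1)) = Red \<and> hue (\<alpha> (k + 1)) = Green))"

definition tiles_plane :: "tile set \<Rightarrow> bool" where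
  "tiles_plane T \<longleftrightarrow>
    (\<forall>t\<in>T. square_tile t) \<and>
    (\<Union>t\<in>T. square (center t)) = UNIV \<and>
    (\<forall>t\<in>T. \<forall>t'\<in>T. t \<noteq> t' \<longrightarrow>
       interior (square (center t)) \<inter> interior (square (center t')) = {})"

definition edge_to_edge :: "tile set \<Rightarrow> bool" where
  "edge_to_edge T \<longleftrightarrow>
    (\<forall>t\<in>T. \<forall>t'\<in>T. t \<noteq> t' \<longrightarrow>
      (let z = center t; z' = center t'; I = square z \<inter> square z' in
        I = {} \<or>
        (\<exists>j k. I = {corner z j} \<and> I = {corner z' k}) \<or>
        (\<exists>j k. I = edge z j \<and> I = edge z' k)))"

definition correct_tiling :: "tile set \<Rightarrow> bool" where
  "correct_tiling T \<longleftrightarrow>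
    tiles_plane T \<and>
    edge_to_edge T \<and>
    (\<forall>t\<in>T. \<forall>t'\<in>T. \<forall>\<alpha>\<in>sides t. \<forall>\<beta>\<in>sides t'. support \<alpha> = support \<beta> \<longrightarrow> \<alpha> = \<beta>) \<and>
    (\<forall>t\<in>T. \<forall>t'\<in>T. \<forall>(X, c)\<in>triangles t. \<forall>(Y, d)\<in>triangles t'.
       X \<noteq> Y \<and> (\<exists>p q. p \<noteq> q \<and> {p, q} \<subseteq> X \<inter> Y) \<longrightarrow> c \<noteq> d) \<and>
    (\<forall>t\<in>T. \<forall>j. legal_crossing (corner (center t) j) (crossing T (corner (center t) j)))"

definition periodic :: "tile set \<Rightarrow> bool" where
  "periodic T \<longleftrightarrow> (\<exists>a. a \<noteq> 0 \<and> translate_tile a ` T = T)"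

end

theory Submission
  imports Defs
begin

text \<open>
  Rule (2) forces the axes of adjacent tiles to be perpendicular, so the axes join vertices of one
  colour class of the checkerboard of vertices.  At a vertex of the other class all four half-diagonals
  leave, hence the axis of its crossing runs along two sides.  Such a vertex is therefore the centre of a
  tile of side \<open>\<surd>2\<close>, turned by \<open>45\<close> degrees: its half-diagonals are the old sides at the vertex, its
  sides are the old axes, and the hue of a triangle is the hue of the old half-diagonal inside it.  The
  larger tiles again form a correct tiling.  As the old tiling determines the new one, every period of the
  old one is a period of the new one, so it is divisible by \<open>1 + \<i>\<close> in the Gaussian integers, and again
  after each iteration; only the zero vector has this property.

  Conversely the larger tiling determines the smaller one.  A tiling of which one vertex is a corner of
  tiles of all scales exists because the value of an arrow can be traced back through the scales: it
  reaches a vertex that is a centre, where the hues are fixed by the checkerboard, or that one vertex.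
\<close>

section \<open>Arrows on the integer lattice\<close>

text \<open>Both halves pass through one combinatorial object, \<open>coherent\<close>: eight values
  at every lattice point, subject to local conditions. Of the triangles only the checkerboard parity
  \<open>e\<close> survives in it. It is a parameter because composition produces a new parity that
  is not known in advance: it is read off from the hues of the old half-diagonals. The step that
  makes composition work is a match of two rules. At a vertex where all half-diagonals leave, their
  hues decide along which pair of sides the axis of the crossing runs; and since the two halves of a
  diagonal that is not an axis differ in hue, this choice alternates from each such vertex to the
  next, which is what a checkerboard of axes requires one scale up. The obstacle for existence is
  that a value may have to be fetched from the far end of a side, which can lie farther from the
  fixed vertex; the recursion therefore needs a measure finer than the distance.\<close>

text \<open>Direction \<open>k\<close> makes the angle \<open>k\<close> times \<open>45\<close> degrees with the positive real axis; the steps in odd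
  directions are diagonals of unit squares.\<close>

definition dx :: "nat \<Rightarrow> int" where
  "dx k = (if k mod 8 \<in> {0, 1, 7} then 1 else if k mod 8 \<in> {3, 4, 5} then - 1 else 0)"

text \<open>The sine as a cosine shifted by a quarter turn: adding \<open>6\<close> subtracts
  \<open>2\<close> modulo \<open>8\<close>. Backward turns are written as additions throughout,
  which avoids truncated subtraction on \<open>nat\<close>.\<close>

definition dy :: "nat \<Rightarrow> int" where
  "dy k = dx (k + 6)"



lemma mod8_cases:
  obtains "k mod 8 = 0" | "k mod 8 = 1" | "k mod 8 = 2" | "k mod 8 = 3"
  | "k mod 8 = 4" | "k mod 8 = 5" | "k mod 8 = 6" | "k mod 8 = (7::nat)"
proof -
  have "k mod 8 \<in> {0, 1, 2, 3, 4, 5, 6, 7}" by auto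
  then show ?thesis using that by (simp only: insert_iff empty_iff) (elim disjE, simp_all)
qed

lemma dx_cong: "j mod 8 = k mod 8 \<Longrightarrow> dx j = dx k"
  by (simp add: dx_def)

lemma dy_cong: "j mod 8 = k mod 8 \<Longrightarrow> dy j = dy k"
  unfolding dy_def by (intro dx_cong mod_add_cong) simp_all

lemma dx_mod: "dx k = dx (k mod 8)" "dx (k + j) = dx (k mod 8 + j)" "dx (Suc k) = dx (Suc (k mod 8))"
  by (rule dx_cong, simp add: mod_simps)+

lemma dy_mod: "dy k = dy (k mod 8)" "dy (k + j) = dy (k mod 8 + j)" "dy (Suc k) = dy (Suc (k mod 8))"
  by (rule dy_cong, simp add: mod_simps)+

lemma parity_mod8: "even k \<longleftrightarrow> even (k mod 8 :: nat)"
  by (simp add: dvd_mod_iff)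

lemma even_mod8: "even k \<Longrightarrow> k mod 8 = 0 \<or> k mod 8 = 2 \<or> k mod 8 = 4 \<or> k mod 8 = (6 :: nat)"
  by (cases rule: mod8_cases[of k]) (auto simp: parity_mod8[of k])

lemma dx_add_8 [simp]: "dx (k + 8) = dx k" and dy_add_8 [simp]: "dy (k + 8) = dy k"
  by (rule dx_cong dy_cong, simp)+

lemma dx_add_4 [simp]: "dx (k + 4) = - dx k" and dy_add_4 [simp]: "dy (k + 4) = - dy k"
  by (cases rule: mod8_cases[of k]; simp add: dx_mod[of k] dy_mod[of k]; simp add: dx_def dy_def)+

text \<open>Multiplication by \<open>1 + \<i>\<close> turns by one direction and stretches by
  \<surd>2. It takes a side step to the next diagonal step, whereas a diagonal step goes to twice
  the next side step; this is how the old and the new lattice are compared.\<close>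

lemma d_even_Suc:
  assumes "even k"
  shows "dx (Suc k) = dx k - dy k" "dy (Suc k) = dx k + dy k"
  using assms
    by (cases rule: mod8_cases[of k]; simp add: dx_mod[of k] dy_mod[of k] parity_mod8[of k]; simp add: dx_def dy_def)+

lemma d_odd_Suc:
  assumes "odd k"
  shows "dx k - dy k = 2 * dx (Suc k)" "dx k + dy k = 2 * dy (Suc k)"
  using assms
    by (cases rule: mod8_cases[of k]; simp add: dx_mod[of k] dy_mod[of k] parity_mod8[of k]; simp add: dx_def dy_def)+

lemma parity_d [simp]: "even (dx k + dy k) \<longleftrightarrow> odd k"
  by (cases rule: mod8_cases[of k]; simp add: dx_mod[of k] dy_mod[of k] parity_mod8[of k]; simp add: dx_def dy_def)+

lemma odd_d: "odd k \<Longrightarrow> odd (dx k) \<and> odd (dy k)"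
  by (cases rule: mod8_cases[of k]; simp add: dx_mod[of k] dy_mod[of k] parity_mod8[of k]; simp add: dx_def dy_def)+
text \<open>A pair \<open>(b, c)\<close> stands for an arrow at a vertex: \<open>b\<close> says that it leaves the vertex, \<open>c\<close> is its
  hue.  The other end of an arrow sees the flipped pair.\<close>

definition flip :: "bool \<times> color \<Rightarrow> bool \<times> color" where
  "flip p = (\<not> fst p, snd p)"

lemma flip_flip [simp]: "flip (flip p) = p"
  and fst_flip [simp]: "fst (flip p) \<longleftrightarrow> \<not> fst p"
  and snd_flip [simp]: "snd (flip p) = snd p"
  by (simp_all add: flip_def)

lemma color_neq: "(a :: color) \<noteq> b \<Longrightarrow> b \<noteq> c \<Longrightarrow> a = c"
  by (cases a; cases b; cases c) auto

text \<open>\<open>m\<close> is the direction in which the axis leaves. For someone entering along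
  \<open>m + 2\<close> or \<open>m + 6\<close> the left neighbour is the one with the smaller index,
  hence the sequence red, green, red, green.\<close>

definition legal_at :: "(nat \<Rightarrow> bool \<times> color) \<Rightarrow> nat \<Rightarrow> bool" where
  "legal_at f m \<longleftrightarrow>
     fst (f m) \<and> f (m + 4) = flip (f m) \<and>
     \<not> fst (f (m + 2)) \<and> \<not> fst (f (m + 6)) \<and> snd (f (m + 2)) \<noteq> snd (f (m + 6)) \<and>
     f (m + 1) = (True, Red) \<and> f (m + 3) = (True, Green) \<and>
     f (m + 5) = (True, Red) \<and> f (m + 7) = (True, Green)"

text \<open>\<open>X x y k\<close> is the arrow in direction \<open>k\<close> at the vertex \<open>(x, y)\<close>: a side for even \<open>k\<close>, a half-diagonal
  for odd \<open>k\<close>.  The axes of the tiles join vertices with \<open>x + y + e\<close> even.\<close>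

locale coherent =
  fixes X :: "int \<Rightarrow> int \<Rightarrow> nat \<Rightarrow> bool \<times> color" and e :: int
  assumes period: "X x y (k + 8) = X x y k"
    and legal: "\<exists>m. legal_at (X x y) m"
    and ends_flip: "even k \<or> even (x + y + e) \<Longrightarrow> X (x + dx k) (y + dy k) (k + 4) = flip (X x y k)"
    and diagonal_leaves: "odd k \<Longrightarrow> odd (x + y + e) \<Longrightarrow> fst (X x y k)"
    and diagonal_hue: "odd k \<Longrightarrow> odd (x + y + e) \<Longrightarrow>
      snd (X (x + dx k) (y + dy k) (k + 4)) \<noteq> snd (X x y k)"

lemma period8_mod:
  fixes f :: "nat \<Rightarrow> 'a"
  assumes "\<And>k. f (k + 8) = f k"
  shows "f k = f (k mod 8)"
proof -
  have "f (r + 8 * q) = f r" for r q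
  proof (induction q)
    case (Suc q)
    have "f (r + 8 * Suc q) = f ((r + 8 * q) + 8)" by (simp add: algebra_simps)
    with Suc assms show ?case by metis
  qed simp
  from this[of "k mod 8" "k div 8"] show ?thesis by simp
qed

lemma period8_cong:
  fixes f :: "nat \<Rightarrow> 'a"
  assumes "\<And>k. f (k + 8) = f k" "j mod 8 = k mod 8"
  shows "f j = f k"
  using period8_mod[of f, OF assms(1)] assms(2) by metis

text \<open>Produces the parity \<open>e\<close> of a coherent pattern, both for the hues at the
  centres of the larger tiles and for the axes of the tiles of a given tiling.\<close>

lemma alternating:
  fixes g :: "int \<Rightarrow> int \<Rightarrow> bool"
  assumes x: "\<And>x y. g (x + 1) y \<longleftrightarrow> \<not> g x y" and y: "\<And>x y. g x (y + 1) \<longleftrightarrow> \<not> g x y"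
  shows "g x y \<longleftrightarrow> (g 0 0 \<longleftrightarrow> even (x + y))"
proof -
  have 1: "g x 0 \<longleftrightarrow> (g 0 0 \<longleftrightarrow> even x)" for x
  proof (induction x rule: int_induct[where k = 0])
    case (step1 i) then show ?case using x[of i 0] by auto
  next
    case (step2 i) then show ?case using x[of "i - 1" 0] by auto
  qed auto
  have 2: "g x y \<longleftrightarrow> (g x 0 \<longleftrightarrow> even y)" for y
  proof (induction y rule: int_induct[where k = 0])
    case (step1 i) then show ?case using y[of x i] by auto
  next
    case (step2 i) then show ?case using y[of x "i - 1"] by auto
  qed auto
  show ?thesis using 1[of x] 2[of y] unfolding even_add by argo
qed

section \<open>Composition into larger tiles\<close>

text \<open>The new lattice is the image of the old one under multiplication by \<open>1 + \<i>\<close>, shifted so that it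
  consists of the vertices on axes; its directions are turned by one step.\<close>

definition compose ::
  "(int \<Rightarrow> int \<Rightarrow> nat \<Rightarrow> bool \<times> color) \<Rightarrow> int \<Rightarrow> int \<Rightarrow> int \<Rightarrow> nat \<Rightarrow> bool \<times> color" where
  "compose X e x y k = X (x - y + e) (x + y) (Suc k)"

lemma legal_at_Suc:
  assumes "legal_at f m" and "\<And>k. f (k + 8) = f k"
  shows "legal_at (\<lambda>k. f (Suc k)) (m + 7)"
proof -
  have "f (Suc (m + 7)) = f m" using assms(2)[of m] by (simp add: add.commute)
  moreover have "f (Suc (m + 7 + j)) = f (m + j)" for j
    using assms(2)[of "m + j"] by (simp add: algebra_simps)
  ultimately show ?thesis using assms(1) by (simp only: legal_at_def simp_thms)
qed

text \<open>A crossing whose diagonal arrows all leave has its axis along a side; the hue in direction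
  \<open>1\<close> tells along which of the two sides.\<close>

lemma legal_at_diagonals_leave:
  assumes per: "\<And>k. f (k + 8) = f k" and leg: "legal_at f m"
    and out: "\<And>k. odd k \<Longrightarrow> fst (f k)"
  shows "snd (f 5) = snd (f 1)" "snd (f 3) \<noteq> snd (f 1)" "snd (f 7) = snd (f 3)"
    and "even k \<Longrightarrow> (snd (f 1) = Red \<longleftrightarrow> k mod 4 = 0) \<Longrightarrow> f (k + 4) = flip (f k)"
    and "even k \<Longrightarrow> (snd (f 1) = Red \<longleftrightarrow> k mod 4 \<noteq> 0) \<Longrightarrow>
           \<not> fst (f k) \<and> \<not> fst (f (k + 4)) \<and> snd (f (k + 4)) \<noteq> snd (f k)"
proof -
  \<comment> \<open>An axis in an odd direction would have an entering arrow \<open>m + 4\<close>,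
    but all arrows in odd directions leave.\<close>
  have m: "even m"
  proof (rule ccontr)
    assume "odd m"
    then have "fst (f (m + 4))" "fst (f m)" by (simp_all add: out)
    with leg show False by (simp add: legal_at_def)
  qed
  have f: "f j = f (j mod 8)" for j using period8_mod[of f] per by blast
  have g: "f (m + j) = f ((m mod 8 + j) mod 8)" for j
    using f[of "m + j"] by (simp add: mod_add_left_eq)
  have m8: "m mod 8 = 0 \<or> m mod 8 = 2 \<or> m mod 8 = 4 \<or> m mod 8 = 6"
    using m by (rule even_mod8)
  note L = leg[unfolded legal_at_def g g[of 0, simplified]]
  \<comment> \<open>Directions \<open>m + 1\<close> and \<open>m + 5\<close> are red,
    \<open>m + 3\<close> and \<open>m + 7\<close> green, so for even \<open>m\<close> the hue in
    direction \<open>1\<close> reveals \<open>m\<close> modulo \<open>4\<close>.\<close>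
  have v: "snd (f 1) = Red \<longleftrightarrow> m mod 4 = 0"
    "snd (f 5) = snd (f 1)"
    "snd (f 3) \<noteq> snd (f 1)"
    "snd (f 7) = snd (f 3)"
    using m8 L by (elim disjE; simp add: mod_mod_cancel[of 4 8 m, symmetric])+
  then show "snd (f 5) = snd (f 1)" "snd (f 3) \<noteq> snd (f 1)" "snd (f 7) = snd (f 3)"
    by blast+
  have k8: "f k = f (k mod 8)" "f (k + 4) = f ((k mod 8 + 4) mod 8)"
    using f[of "k + 4"] f[of k] by (simp_all add: mod_add_left_eq)
  have k4: "k mod 4 = (k mod 8) mod 4" "m mod 4 = (m mod 8) mod 4" by (simp_all add: mod_mod_cancel)
  have kk: "k mod 8 = 0 \<or> k mod 8 = 2 \<or> k mod 8 = 4 \<or> k mod 8 = 6" if "even k"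
    using that by (rule even_mod8)
  show "f (k + 4) = flip (f k)" if "even k" "snd (f 1) = Red \<longleftrightarrow> k mod 4 = 0"
    using that(2) m8 kk[OF that(1)] L unfolding v k8 k4 by (elim disjE; simp)
  show "\<not> fst (f k) \<and> \<not> fst (f (k + 4)) \<and> snd (f (k + 4)) \<noteq> snd (f k)"
    if "even k" "snd (f 1) = Red \<longleftrightarrow> k mod 4 \<noteq> 0"
    using that(2) m8 kk[OF that(1)] L unfolding v k8 k4
      by (elim disjE; simp del: add_2_eq_Suc add_2_eq_Suc'; auto)
qed

text \<open>For even \<open>k\<close> the new conditions are those on the old axes. For odd
  \<open>k\<close> a new diagonal consists of two collinear old sides that meet at a vertex off the
  old axes, and the crossing there either continues one side in the other or lets both enter with
  different hues.\<close>

lemma coherent_compose: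
  assumes X: "coherent X e"
  obtains e' where "coherent (compose X e) e'"
proof -
  note per = coherent.period[OF X] and flp = coherent.ends_flip[OF X] and hue = coherent.diagonal_hue[OF X]
  have out: "fst (X p r k)" if "odd (p + r + e)" "odd k" for p r k
    using coherent.diagonal_leaves[OF X that(2,1)] .
  \<comment> \<open>This old vertex is the centre of the new square with south-west corner
    \<open>(x, y)\<close>: new direction \<open>1\<close> is old direction \<open>2\<close>.\<close>
  define g where "g x y = (snd (X (x - y + e) (x + y + 1) 1) = Red)" for x y
  \<comment> \<open>The diagonal leading from \<open>(p, r)\<close> to the next centre is not an
    axis, so its two halves differ in hue. As opposite directions agree in hue at each centre, and
    directions \<open>1\<close> and \<open>3\<close> differ, the hue in direction \<open>1\<close>
    changes too.\<close>
  have diag: "snd (X (p + dx k) (r + dy k) 1) = Red \<longleftrightarrow> snd (X p r 1) \<noteq> Red"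
    if "odd (p + r + e)" "k \<in> {1, 3}" for p r k
  proof -
    have k: "odd k" using that(2) by auto
    then have o: "odd (p + dx k + (r + dy k) + e)" using that(1) parity_d[of k] by auto
    obtain m m' where m: "legal_at (X p r) m" and m': "legal_at (X (p + dx k) (r + dy k)) m'"
      using coherent.legal[OF X] by blast
    note 1 = legal_at_diagonals_leave[OF per m out[OF that(1)]]
      and 2 = legal_at_diagonals_leave[OF per m' out[OF o]]
    have "snd (X (p + dx k) (r + dy k) 1) \<noteq> snd (X p r 1)"
      using that(2)
    proof (elim insertE)
      assume "k = 1"
      then show ?thesis using hue[OF k that(1)] 2(1) by simp
    next
      assume "k = 3"
      then show ?thesis using hue[OF k that(1)] 1(2) 2(2,3) by (auto dest: color_neq)
    qed simp
    then show ?thesis by (cases "snd (X p r 1)"; cases "snd (X (p + dx k) (r + dy k) 1)") simp_all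
  qed
  have gx: "g (x + 1) y \<longleftrightarrow> \<not> g x y" and gy: "g x (y + 1) \<longleftrightarrow> \<not> g x y" for x y
    using diag[of "x - y + e" "x + y + 1" 1] diag[of "x - y + e" "x + y + 1" 3]
    by (simp_all add: g_def dx_def dy_def algebra_simps)
  note g = alternating[of g, OF gx gy]
  \<comment> \<open>Red at the centre of the new square at the origin puts the axis of its crossing
    along the old directions \<open>0\<close> and \<open>4\<close>, the new directions
    \<open>7\<close> and \<open>3\<close>. The new axis then joins the north-west and south-east
    corners, whose coordinate sums are odd.\<close>
  define e' :: int where "e' = (if g 0 0 then 1 else 0)"
  have center: "snd (X p r 1) = Red \<longleftrightarrow> odd (r + 1 + e')" if "odd (p + r + e)" for p r
  proof -
    define x where "x = (p + r - 1 - e) div 2"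
    define y where "y = r - 1 - x"
    have "2 * x = p + r - 1 - e" unfolding x_def using that by presburger
    then have "p = x - y + e" "r = x + y + 1" by (simp_all add: y_def)
    then show ?thesis using g[of x y] by (auto simp: g_def e'_def)
  qed
  have "coherent (compose X e) e'"
  proof
    fix x y k
    show "compose X e x y (k + 8) = compose X e x y k"
      using per[of _ _ "Suc k"] by (simp add: compose_def)
    obtain m where "legal_at (X (x - y + e) (x + y)) m" using coherent.legal[OF X] by blast
    from legal_at_Suc[of "X (x - y + e) (x + y)", OF this per]
    show "\<exists>m. legal_at (compose X e x y) m"
      by (auto simp: compose_def[abs_def])
  next
    fix x y k
    define p r where "p = x - y + e" and "r = x + y"
    have even: "even (p + r + e)" by (simp add: p_def r_def)
    \<comment> \<open>For odd \<open>k\<close> this is the midpoint of the new diagonal in direction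
      \<open>k\<close>.\<close>
    define q s where "q = p + dx (Suc k)" and "s = r + dy (Suc k)"
    have odd: "odd (q + s + e)" if "odd k"
      using even parity_d[of "Suc k"] that by (auto simp: q_def s_def)
    obtain m where m: "legal_at (X q s) m" using coherent.legal[OF X] by blast
    note l = legal_at_diagonals_leave[OF per m out[OF odd]]
    have end1: "X q s (Suc k + 4) = flip (compose X e x y k)" if "odd k"
      using flp[of "Suc k" p r] that by (simp add: compose_def p_def q_def r_def s_def)
    have end2: "compose X e (x + dx k) (y + dy k) (k + 4) = flip (X q s (Suc k))" if "odd k"
    proof -
      have "x + dx k - (y + dy k) + e = q + dx (Suc k)" "x + dx k + (y + dy k) = s + dy (Suc k)"
        using d_odd_Suc[OF that] by (simp_all add: q_def s_def p_def r_def)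
      then show ?thesis using flp[of "Suc k" q s] that by (simp add: compose_def)
    qed
    have s: "snd (X q s 1) = Red \<longleftrightarrow> (Suc k mod 4 = 0 \<longleftrightarrow> even (x + y + e'))" if "odd k"
    proof -
      have "odd (dy (Suc k)) \<longleftrightarrow> Suc k mod 4 \<noteq> 0"
        using that mod_mod_cancel[of 4 8 "Suc k"]
        by (cases rule: mod8_cases[of "Suc k"]; simp add: parity_mod8[of "Suc k"] dy_mod[of "Suc k"] del: even_Suc mod_Suc)
          (simp_all add: dx_def dy_def)
      then show ?thesis using center[OF odd[OF that]] by (auto simp: s_def r_def)
    qed
    show "compose X e (x + dx k) (y + dy k) (k + 4) = flip (compose X e x y k)"
      if "even k \<or> even (x + y + e')"
    proof (cases "even k")
      case True
      then show ?thesis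
        using flp[of "Suc k" p r] even d_even_Suc[OF True]
        by (simp add: compose_def p_def r_def algebra_simps)
    next
      case False
      then have "X q s (Suc k + 4) = flip (X q s (Suc k))"
        using that s l(4)[of "Suc k"] by auto
      then show ?thesis using False end1 end2 by simp
    qed
    assume k: "odd k" and "odd (x + y + e')"
    then have "snd (X q s 1) = Red \<longleftrightarrow> Suc k mod 4 \<noteq> 0" using s by auto
    then have "\<not> fst (X q s (Suc k)) \<and> \<not> fst (X q s (Suc k + 4)) \<and>
       snd (X q s (Suc k + 4)) \<noteq> snd (X q s (Suc k))" using l(5)[OF k, of "Suc k"] k by auto
    then show "fst (compose X e x y k)"
      "snd (compose X e (x + dx k) (y + dy k) (k + 4)) \<noteq> snd (compose X e x y k)"
      using end1[OF k] end2[OF k] by auto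
  qed
  then show ?thesis by (rule that)
qed

text \<open>Infinite descent on the squared norm of the period, which division by
  \<open>1 + \<i>\<close> halves. The quotient is a period of the composed pattern, so
  \<open>X\<close> and \<open>e\<close> vary in the induction.\<close>

lemma coherent_aperiodic:
  assumes "coherent X e" and "\<And>x y. X (x + a) (y + b) = X x y"
  shows "a = 0 \<and> b = 0"
  using assms
proof (induction "nat (a\<^sup>2 + b\<^sup>2)" arbitrary: X e a b rule: less_induct)
  case less
  note X = less.prems(1) and p = less.prems(2)
  \<comment> \<open>An odd period would exchange the two vertex classes, so all half-diagonals would
    leave everywhere. But the axis between \<open>(e, 0)\<close> and \<open>(e + 1, 1)\<close>
    enters at one end.\<close>
  have ev: "even (a + b)"
  proof (rule ccontr)
    assume o: "odd (a + b)"
    have "fst (X x y k)" if "odd k" "even (x + y + e)" for x y k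
      using coherent.diagonal_leaves[OF X \<open>odd k\<close>, of "x + a" "y + b"] o that p[of x y]
        by auto
    from this[of 1 e 0] this[of 5 "e + 1" 1] coherent.ends_flip[OF X, of 1 e 0] show False
      by (simp add: dx_def dy_def)
  qed
  define a' b' where "a' = (a + b) div 2" and "b' = (b - a) div 2"
  have ab: "a' - b' = a" "a' + b' = b" using ev unfolding a'_def b'_def by presburger+
  show ?case
  proof (rule ccontr)
    assume ne: "\<not> (a = 0 \<and> b = 0)"
    have "a\<^sup>2 + b\<^sup>2 = 2 * (a'\<^sup>2 + b'\<^sup>2)"
      unfolding ab[symmetric] by (simp add: power2_eq_square algebra_simps)
    moreover have pos: "a\<^sup>2 + b\<^sup>2 > 0" using ne by (simp add: sum_power2_gt_zero_iff)
    moreover have "t < s" if "s = 2 * t" "0 < s" for s t :: int using that by linarith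
    ultimately have "a'\<^sup>2 + b'\<^sup>2 < a\<^sup>2 + b\<^sup>2" by blast
    then have "nat (a'\<^sup>2 + b'\<^sup>2) < nat (a\<^sup>2 + b\<^sup>2)" using pos by simp
    moreover obtain e' where "coherent (compose X e) e'" by (rule coherent_compose[OF X])
    moreover have "compose X e (x + a') (y + b') = compose X e x y" for x y
    proof -
      have "x + a' - (y + b') + e = x - y + e + a" "x + a' + (y + b') = x + y + b" using ab by simp_all
      then show ?thesis unfolding compose_def[abs_def] by (simp only: p)
    qed
    ultimately have "a' = 0 \<and> b' = 0" by (rule less.hyps)
    with ab ne show False by simp
  qed
qed

section \<open>A coherent pattern\<close>

lemma d_add_2: "dx (k + 2) = - dy k" "dy (k + 2) = dx k"
proof -
  show "dy (k + 2) = dx k" unfolding dy_def by (rule dx_cong) simp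
  have "k + 2 + 4 = k + 6" by simp
  then show "dx (k + 2) = - dy k" by (metis dx_add_4 dy_def minus_minus)
qed

lemma abs_d_odd: "odd k \<Longrightarrow> \<bar>dx k\<bar> = 1 \<and> \<bar>dy k\<bar> = 1"
  by (cases rule: mod8_cases[of k]; simp add: dx_mod[of k] dy_mod[of k] parity_mod8[of k]; simp add: dx_def dy_def)

text \<open>A crossing with its axis in direction \<open>0\<close>, for the common vertex of all
  scales. Legality leaves open the hue of the axis and the order of the two perpendicular hues; here
  the axis is red, and so is direction \<open>2\<close>.\<close>

definition star :: "nat \<Rightarrow> bool \<times> color" where
  "star j = (j mod 8 \<noteq> 4 \<and> j mod 8 \<noteq> 2 \<and> j mod 8 \<noteq> 6, if j mod 8 \<in> {3, 6, 7} then Green else Red)"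

lemma star_cong: "i mod 8 = j mod 8 \<Longrightarrow> star i = star j"
  by (simp add: star_def)

lemma legal_star: "legal_at star 0"
  by (simp add: legal_at_def star_def flip_def)

lemma nat_strict_mono: "a < b \<Longrightarrow> 0 \<le> a \<Longrightarrow> nat a < nat b"
  by simp

lemma double_indicator_less:
  fixes a b :: nat
  shows "a < b \<Longrightarrow> 2 * a + (if P then 1 else 0) < 2 * b + (if Q then 1 else 0)"
    and "a = b \<Longrightarrow> \<not> P \<Longrightarrow> Q \<Longrightarrow> 2 * a + (if P then 1 else 0) < 2 * b + (if Q then 1 else 0)"
  by simp_all

text \<open>\<open>half_diagonal n x y k\<close> is meaningful for odd \<open>k\<close>.  At a vertex with odd \<open>x + y\<close>, a centre of the next
  larger scale, it is given by the checkerboard.  At the other vertices it is a side of the next larger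
  scale, hence a half-diagonal two scales up, whose coordinates are divided by \<open>2 * \<i>\<close>; if \<open>x\<close> is odd, one
  has to walk to the other end of the side first.  The scale \<open>n\<close> only matters modulo \<open>8\<close>, through the
  rotation of the crossing at the origin, and \<open>n + 7\<close> is the next larger scale.\<close>

function half_diagonal :: "nat \<Rightarrow> int \<Rightarrow> int \<Rightarrow> nat \<Rightarrow> bool \<times> color" where
  "half_diagonal n x y k =
    (if even k \<or> odd (x + y) then (True, if k mod 4 = 1 \<longleftrightarrow> even y then Red else Green)
     else if x = 0 \<and> y = 0 then star (k + 7 * n)
     else if even x then half_diagonal (n + 6) (y div 2) (- (x div 2)) (k + 6)
     else flip (half_diagonal (n + 6) ((y + dy k) div 2) (- ((x + dx k) div 2)) (k + 2)))"
  by auto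
termination
\<comment> \<open>The size of the vertex can stay the same only for an arrow at
  \<open>(\<plusminus>1, \<plusminus>1)\<close> pointing away from the origin: the walk ends at
  \<open>(\<plusminus>2, \<plusminus>2)\<close> and halving leads back to the old size. The flag
  records this situation.\<close>
proof (relation "Wellfounded.measure (\<lambda>(n, x, y, k). 2 * nat (\<bar>x\<bar> + \<bar>y\<bar>) + (if x = dx k \<and> y = dy k then 1 else 0))",
    goal_cases)
  case 1
  then show ?case by simp
next
  case (2 n x y k)
  then have "even x" "even y" by simp_all
  then obtain a b where ab: "x = 2 * a" "y = 2 * b" by (elim evenE)
  then have "0 < \<bar>a\<bar> + \<bar>b\<bar>" using 2(2) by (cases "a = 0") auto
  then have "\<bar>y div 2\<bar> + \<bar>- (x div 2)\<bar> < \<bar>x\<bar> + \<bar>y\<bar>"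
    unfolding ab by simp
  then have "nat (\<bar>y div 2\<bar> + \<bar>- (x div 2)\<bar>) < nat (\<bar>x\<bar> + \<bar>y\<bar>)"
    by (rule nat_strict_mono) simp
  then show ?case unfolding in_measure prod.case by (rule double_indicator_less(1))
next
  case (3 n x y k)
  then have "odd x" "odd y" by auto
  then obtain a b where a: "x = 2 * a + 1" and b: "y = 2 * b + 1" by (elim oddE)
  have "odd k" using 3 by simp
  note d = abs_d_odd[OF this]
  define x' y' where "x' = (y + dy k) div 2" and "y' = - ((x + dx k) div 2)"
  have x': "\<bar>x'\<bar> \<le> \<bar>y\<bar>"
    "x' \<noteq> dy k \<or> y \<noteq> dy k \<Longrightarrow> \<bar>x'\<bar> < \<bar>y\<bar>"
    using d unfolding x'_def b by (auto simp: abs_if split: if_splits)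
  have y': "\<bar>y'\<bar> \<le> \<bar>x\<bar>"
    "y' \<noteq> - dx k \<or> x \<noteq> dx k \<Longrightarrow> \<bar>y'\<bar> < \<bar>x\<bar>"
    using d unfolding y'_def a by (auto simp: abs_if split: if_splits)
  show ?case
  proof (cases "x = dx k \<and> y = dy k \<and> x' = dy k \<and> y' = - dx k")
    \<comment> \<open>Position and direction are turned by right angles in opposite senses, so the
      new arrow points towards the origin and the flag drops to \<open>0\<close>.\<close>
    case True
    then have e: "x' = dy k" "y' = - dx k" "x = dx k \<and> y = dy k" by blast+
    have "dy k \<noteq> 0" using d by linarith
    then have 1: "\<not> (x' = dx (k + 2) \<and> y' = dy (k + 2))" unfolding d_add_2 e(1) by linarith
    have 2: "nat (\<bar>x'\<bar> + \<bar>y'\<bar>) = nat (\<bar>x\<bar> + \<bar>y\<bar>)"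
      unfolding e(1,2) conjunct1[OF e(3)] conjunct2[OF e(3)] by (simp add: add.commute)
    from 2 1 e(3) show ?thesis
      unfolding x'_def[symmetric] y'_def[symmetric] in_measure prod.case
        by (rule double_indicator_less(2))
  next
    case False
    then have "\<bar>x'\<bar> < \<bar>y\<bar> \<or> \<bar>y'\<bar> < \<bar>x\<bar>"
      using x'(2) y'(2) by blast
    then have "\<bar>x'\<bar> + \<bar>y'\<bar> < \<bar>x\<bar> + \<bar>y\<bar>"
      using x'(1) y'(1) by linarith
    then have "nat (\<bar>x'\<bar> + \<bar>y'\<bar>) < nat (\<bar>x\<bar> + \<bar>y\<bar>)"
      by (rule nat_strict_mono) simp
    then show ?thesis unfolding x'_def[symmetric] y'_def[symmetric] in_measure prod.case by (rule double_indicator_less(1))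
  qed
qed

declare half_diagonal.simps [simp del]

text \<open>Since backward turns are additions, one step over two scales adds \<open>6\<close> where
  two steps over one scale add \<open>14\<close>; this lemma identifies them.\<close>

lemma half_diagonal_cong:
  assumes "j mod 8 = k mod 8" "n mod 8 = m mod 8"
  shows "half_diagonal n x y j = half_diagonal m x y k"
  using assms
proof (induction n x y j arbitrary: m k rule: half_diagonal.induct)
  case (1 n x y j)
  have p: "even j \<longleftrightarrow> even k" using parity_mod8 "1.prems"(1) by metis
  have "i mod 4 = i mod 8 mod 4" for i :: nat by (simp add: mod_mod_cancel)
  then have m4: "j mod 4 = k mod 4" using "1.prems"(1) by metis
  have s: "star (j + 7 * n) = star (k + 7 * m)"
    using "1.prems" by (intro star_cong mod_add_cong mod_mult_cong) auto
  have d: "dx j = dx k" "dy j = dy k" using "1.prems"(1) dx_cong dy_cong by blast+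
  have 6: "(j + 6) mod 8 = (k + 6) mod 8" "(j + 2) mod 8 = (k + 2) mod 8" "(n + 6) mod 8 = (m + 6) mod 8"
    using "1.prems" by (intro mod_add_cong; simp)+
  note IH = "1.IH"(1)[OF _ _ _ 6(1) 6(3)] "1.IH"(2)[OF _ _ _ 6(2) 6(3)]
  show ?case
    unfolding half_diagonal.simps[of n x y j] half_diagonal.simps[of m x y k] p m4 s d
    using IH[unfolded p d] by (intro if_cong refl arg_cong[where f = flip]; blast)
qed

text \<open>A side is a half-diagonal one scale up: the coordinates are divided by
  \<open>1 + \<i>\<close> and the direction turns back by one, hence \<open>k + 7\<close>. From a
  vertex with odd \<open>x + y\<close> it is read at its other end, where its direction is
  \<open>k + 4\<close>, hence \<open>k + 3\<close> modulo \<open>8\<close>.\<close>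

definition arrows :: "nat \<Rightarrow> int \<Rightarrow> int \<Rightarrow> nat \<Rightarrow> bool \<times> color" where
  "arrows n x y k =
    (if odd k then half_diagonal n x y k
     else if even (x + y) then half_diagonal (n + 7) ((x + y) div 2) ((y - x) div 2) (k + 7)
     else flip (half_diagonal (n + 7) ((x + dx k + (y + dy k)) div 2) ((y + dy k - (x + dx k)) div 2) (k + 3)))"

lemma arrows_cong:
  assumes "j mod 8 = k mod 8" "n mod 8 = m mod 8"
  shows "arrows n x y j = arrows m x y k"
proof -
  have p: "even j \<longleftrightarrow> even k" using parity_mod8 assms(1) by metis
  have d: "dx j = dx k" "dy j = dy k" using assms(1) dx_cong dy_cong by blast+
  have 6: "(j + 7) mod 8 = (k + 7) mod 8" "(j + 3) mod 8 = (k + 3) mod 8" "(n + 7) mod 8 = (m + 7) mod 8"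
    using assms by (intro mod_add_cong; simp)+
  show ?thesis unfolding arrows_def p d
    using half_diagonal_cong[OF assms] half_diagonal_cong[OF 6(1,3)] half_diagonal_cong[OF 6(2,3)]
      by simp
qed

lemma d_add_7:
  "odd k \<Longrightarrow> dx (k + 7) + dy (k + 7) = dy k"
  "odd k \<Longrightarrow> dy (k + 7) - dx (k + 7) = - dx k"
  using d_even_Suc[of "k + 7"] dx_add_8[of k] dy_add_8[of k]
  by (simp_all add: add.commute)

text \<open>For even \<open>k\<close> this is the definition. For odd \<open>k\<close> the
  right-hand side is a side of the larger scale, which \<open>arrows\<close> reads another scale up;
  because \<open>(1 + \<i>)\<^sup>2 = 2 * \<i>\<close> this agrees with the recursion of
  \<open>half_diagonal\<close>.\<close>

lemma arrows_decompose:
  assumes ev: "even (x + y)"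
  shows "arrows n x y k = arrows (n + 7) ((x + y) div 2) ((y - x) div 2) (k + 7)"
proof (cases "odd k")
  case False
  then show ?thesis using ev by (simp add: arrows_def)
next
  case True
  define x' y' where "x' = (x + y) div 2" and "y' = (y - x) div 2"
  have s: "x' + y' = y" "y' - x' = - x" unfolding x'_def y'_def using ev by presburger+
  have L: "arrows n x y k = half_diagonal n x y k" using True by (simp add: arrows_def)
  have r: "(j + 6) mod 8 = (j + 7 + 7) mod 8" "(j + 2) mod 8 = (j + 7 + 3) mod 8" for j :: nat
  proof -
    have "j + 7 + 7 = j + 6 + 8" "j + 7 + 3 = j + 2 + 8" by simp_all
    then show "(j + 6) mod 8 = (j + 7 + 7) mod 8" "(j + 2) mod 8 = (j + 7 + 3) mod 8"
      by (simp_all only: mod_add_self2)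
  qed
  consider "x = 0 \<and> y = 0" | "\<not> (x = 0 \<and> y = 0)" "even y" | "odd y" by blast
  then show ?thesis
  proof cases
    case 1
    \<comment> \<open>Two scales up, the direction gains \<open>14\<close> and the rotation
      \<open>7 * 14\<close>, in all \<open>112 = 8 * 14\<close>: the crossing at the origin is the
      same on all scales, up to the turn of the lattice.\<close>
    have "(k + 7 * n) mod 8 = (k + 7 + 7 + 7 * (n + 7 + 7)) mod 8"
    proof -
      have "k + 7 + 7 + 7 * (n + 7 + 7) = k + 7 * n + 8 * 14" by simp
      then show ?thesis by (simp only: mod_mult_self2)
    qed
    then show ?thesis using 1 True
      by (simp add: arrows_def half_diagonal.simps[of _ 0 0] star_cong[of "k + 7 * n"])
  next
    case 2
    then have "half_diagonal n x y k = half_diagonal (n + 6) (y div 2) (- (x div 2)) (k + 6)"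
      using True ev by (subst half_diagonal.simps) auto
    also have "\<dots> = half_diagonal (n + 7 + 7) (y div 2) (- (x div 2)) (k + 7 + 7)"
      by (intro half_diagonal_cong r)
    also have "- (x div 2) = (- x) div 2" using 2(2) ev by (auto elim!: evenE)
    also have "half_diagonal (n + 7 + 7) (y div 2) (- x div 2) (k + 7 + 7) = arrows (n + 7) x' y' (k + 7)"
      using True 2 s by (simp add: arrows_def del: even_add)
    finally show ?thesis unfolding L x'_def y'_def .
  next
    case 3
    then have "half_diagonal n x y k =
        flip (half_diagonal (n + 6) ((y + dy k) div 2) (- ((x + dx k) div 2)) (k + 2))"
      using True ev by (subst half_diagonal.simps) auto
    also have "\<dots> = flip (half_diagonal (n + 7 + 7) ((y + dy k) div 2) (- ((x + dx k) div 2)) (k + 7 + 3))"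
      by (intro arg_cong[where f = flip] half_diagonal_cong r)
    also have "y + dy k = x' + dx (k + 7) + (y' + dy (k + 7))"
      using s d_add_7(1)[OF True] by simp
    also have "- ((x + dx k) div 2) = (y' + dy (k + 7) - (x' + dx (k + 7))) div 2"
    proof -
      have "even (x + dx k)" using 3 ev odd_d[OF True] by auto
      then obtain c where c: "x + dx k = 2 * c" by (elim evenE)
      have "- ((x + dx k) div 2) = - (x + dx k) div 2" unfolding c by simp
      also have "- (x + dx k) = y' + dy (k + 7) - (x' + dx (k + 7))"
        using s d_add_7(2)[OF True] by simp
      finally show ?thesis .
    qed
    also have "flip (half_diagonal (n + 7 + 7) ((x' + dx (k + 7) + (y' + dy (k + 7))) div 2)
       ((y' + dy (k + 7) - (x' + dx (k + 7))) div 2) (k + 7 + 3)) = arrows (n + 7) x' y' (k + 7)"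
      using True 3 s by (simp add: arrows_def)
    finally show ?thesis unfolding L x'_def y'_def .
  qed
qed

lemma arrows_side:
  assumes k: "even k"
  shows "arrows n (x + dx k) (y + dy k) (k + 4) = flip (arrows n x y k)"
proof -
  have k4: "even (k + 4)" using k by simp
  have s: "even (x + dx k + (y + dy k)) \<longleftrightarrow> odd (x + y)" using parity_d[of k] k by auto
  have h: "half_diagonal (n + 7) a b (k + 4 + 7) = half_diagonal (n + 7) a b (k + 3)" for a b
  proof (rule half_diagonal_cong)
    have "k + 4 + 7 = k + 3 + 8" by simp
    then show "(k + 4 + 7) mod 8 = (k + 3) mod 8" by (simp only: mod_add_self2)
  qed simp
  have c: "k + 4 + 3 = k + 7" "x + dx k + - dx k = x" "y + dy k + - dy k = y" by simp_all
  show ?thesis unfolding arrows_def dx_add_4 dy_add_4 s c h using k k4 by simp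
qed

text \<open>An axis is a side of the next larger scale, so \<open>arrows_side\<close> applies
  there.\<close>

lemma arrows_axis:
  assumes k: "odd k" and ev: "even (x + y)"
  shows "arrows n (x + dx k) (y + dy k) (k + 4) = flip (arrows n x y k)"
proof -
  define x' y' where "x' = (x + y) div 2" and "y' = (y - x) div 2"
  have 2: "even (x + dx k + (y + dy k))" using parity_d[of k] k ev by auto
  have d: "dx k + dy k = 2 * dx (k + 7)" "dy k - dx k = 2 * dy (k + 7)"
    using d_even_Suc[of "k + 7"] k dx_add_8[of k] dy_add_8[of k] by (simp_all add: add.commute)
  have "(x + dx k + (y + dy k)) div 2 = x' + dx (k + 7)"
    "(y + dy k - (x + dx k)) div 2 = y' + dy (k + 7)"
    unfolding x'_def y'_def using d ev by presburger+
  then have "arrows n (x + dx k) (y + dy k) (k + 4) = arrows (n + 7) (x' + dx (k + 7)) (y' + dy (k + 7)) (k + 7 + 4)"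
    using arrows_decompose[OF 2, of n "k + 4"] by (simp add: add.commute add.left_commute)
  also have "\<dots> = flip (arrows (n + 7) x' y' (k + 7))" using k by (intro arrows_side) simp
  also have "arrows (n + 7) x' y' (k + 7) = arrows n x y k"
    unfolding x'_def y'_def by (rule arrows_decompose[OF ev, symmetric])
  finally show ?thesis .
qed

lemma arrows_diagonal:
  assumes "odd k" "odd (x + y)"
  shows "arrows n x y k = (True, if k mod 4 = 1 \<longleftrightarrow> even y then Red else Green)"
  using assms by (simp add: arrows_def half_diagonal.simps)

text \<open>A diagonal step changes the parity of \<open>y\<close>, while the opposite direction
  agrees with \<open>k\<close> modulo \<open>4\<close>.\<close>

lemma arrows_diagonal_hue:
  assumes k: "odd k" and o: "odd (x + y)"
  shows "snd (arrows n (x + dx k) (y + dy k) (k + 4)) \<noteq> snd (arrows n x y k)"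
proof -
  have "odd (x + dx k + (y + dy k))" using parity_d[of k] k o by auto
  moreover have "(k + 4) mod 4 = k mod 4" by simp
  ultimately show ?thesis using k o odd_d[OF k]
    by (simp add: arrows_diagonal)
qed

lemma legal_at_7:
  assumes "legal_at f m" and "\<And>k. f (k + 8) = f k"
  shows "legal_at (\<lambda>k. f (k + 7)) (Suc m)"
proof -
  have "f (Suc m + 7) = f m" using assms(2)[of m] by (simp add: add.commute)
  moreover have "f (Suc m + j + 7) = f (m + j)" for j
    using assms(2)[of "m + j"] by (simp add: algebra_simps)
  ultimately show ?thesis using assms(1) by (simp only: legal_at_def simp_thms)
qed

text \<open>The four sides at such a vertex are the half-diagonals of one larger tile, seen from its
  centre: two form its axis, the other two enter with different hues. The checkerboard hues of the
  smaller half-diagonals are exactly those that this axis demands.\<close>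

lemma arrows_legal_center:
  assumes o: "odd (x + y)"
  shows "\<exists>m. legal_at (arrows n x y) m"
proof -
  \<comment> \<open>The far end of side \<open>k\<close> in the coordinates of the larger scale;
    \<open>W k\<close> is the value of the side seen from there.\<close>
  define c1 c2 where "c1 k = (x + dx k + (y + dy k)) div 2" and "c2 k = (y + dy k - (x + dx k)) div 2" for k
  define W where "W k = arrows (n + 7) (c1 k) (c2 k) (k + 3)" for k
  have W: "arrows n x y k = flip (W k)" if "even k" for k
    using that o by (simp add: W_def arrows_def c1_def c2_def)
  have par: "c1 k + c2 k = y + dy k" if "even k" for k
    using that o parity_d[of k] unfolding c1_def c2_def by presburger
  have opp: "W (k + 4) = arrows (n + 7) (c1 k + dx (k + 3)) (c2 k + dy (k + 3)) (k + 3 + 4)" if "even k" for k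
  proof -
    have d: "dx (k + 3) = - (dx k + dy k)" "dy (k + 3) = dx k - dy k"
      using d_add_2[of "Suc k"] d_even_Suc[OF that] by (simp_all add: numeral_eq_Suc)
    have "x + - dx k + (y + - dy k) = x + dx k + (y + dy k) + - (dx k + dy k) * 2"
      "y + - dy k - (x + - dx k) = y + dy k - (x + dx k) + (dx k - dy k) * 2" by simp_all
    then have "c1 (k + 4) = c1 k + dx (k + 3)" "c2 (k + 4) = c2 k + dy (k + 3)"
      unfolding c1_def c2_def d dx_add_4 dy_add_4 by (simp_all only: div_mult_self1)
    then show ?thesis by (simp add: W_def add.commute add.left_commute)
  qed
  have axis: "arrows n x y (k + 4) = flip (arrows n x y k)" if "even k" "even (y + dy k)" for k
    using that opp[of k] arrows_axis[of "k + 3" "c1 k" "c2 k" "n + 7"] par[of k]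
    by (simp add: W) (simp add: W_def)
  have perp: "\<not> fst (arrows n x y k)" "\<not> fst (arrows n x y (k + 4))"
      "snd (arrows n x y (k + 4)) \<noteq> snd (arrows n x y k)" if k: "even k" "odd (y + dy k)" for k
  proof -
    have *: "\<not> fst (arrows n x y k)" if "even k" "odd (y + dy k)" for k
      using that par[of k] by (simp add: W) (simp add: W_def arrows_diagonal)
    show "\<not> fst (arrows n x y k)" "\<not> fst (arrows n x y (k + 4))"
      using k *[of k] *[of "k + 4"] by simp_all
    show "snd (arrows n x y (k + 4)) \<noteq> snd (arrows n x y k)"
      using k opp[of k] arrows_diagonal_hue[of "k + 3" "c1 k" "c2 k" "n + 7"] par[of k]
      by (simp add: W) (simp add: W_def)
  qed
  \<comment> \<open>By \<open>par\<close>, an axis of the larger tile is a direction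
    \<open>k\<close> with \<open>y + dy k\<close> even: horizontal for even \<open>y\<close>,
    vertical for odd \<open>y\<close>.\<close>
  define k0 :: nat where "k0 = (if even y then 0 else 2)"
  have k0: "even k0" "even (y + dy k0)" "odd (y + dy (k0 + 2))"
    by (auto simp: k0_def dx_def dy_def)
  define m where "m = (if fst (arrows n x y k0) then k0 else k0 + 4)"
  have m: "even m" "even (y + dy m)" "odd (y + dy (m + 2))" "m mod 4 = k0 mod 4"
    using k0 dy_add_4[of "k0 + 2"] by (auto simp: m_def algebra_simps)
  have "fst (arrows n x y m)" using axis[OF k0(1,2)] by (auto simp: m_def)
  moreover have "arrows n x y (m + 4) = flip (arrows n x y m)" using m axis by blast
  moreover have "\<not> fst (arrows n x y (m + 2))" "\<not> fst (arrows n x y (m + 6))"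
    "snd (arrows n x y (m + 2)) \<noteq> snd (arrows n x y (m + 6))"
    using perp[of "m + 2"] m by (simp_all add: add.commute add.left_commute)
  moreover have "arrows n x y (m + 1) = (True, Red)" "arrows n x y (m + 5) = (True, Red)"
    "arrows n x y (m + 3) = (True, Green)" "arrows n x y (m + 7) = (True, Green)"
  proof -
    have r: "(m + j) mod 4 = (k0 + j) mod 4" for j using m(4) by (metis mod_add_left_eq)
    have "arrows n x y (m + j) = (True, if (k0 + j) mod 4 = 1 \<longleftrightarrow> even y then Red else Green)"
      if "odd j" for j
    proof -
      have "odd (m + j)" using that m(1) by simp
      from arrows_diagonal[OF this o, of n] show ?thesis unfolding r .
    qed
    from this[of 1] this[of 3] this[of 5] this[of 7]
    show "arrows n x y (m + 1) = (True, Red)" "arrows n x y (m + 5) = (True, Red)"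
      "arrows n x y (m + 3) = (True, Green)" "arrows n x y (m + 7) = (True, Green)"
      by (simp_all add: k0_def split: if_splits)
  qed
  ultimately show ?thesis unfolding legal_at_def by blast
qed

text \<open>A vertex other than the origin with even \<open>x + y\<close> is a vertex of the next
  larger scale, at half the squared distance and with the same crossing turned by one direction. The
  climb ends at a centre or at the origin.\<close>

lemma arrows_legal: "\<exists>m. legal_at (arrows n x y) m"
proof (induction "nat (x\<^sup>2 + y\<^sup>2)" arbitrary: n x y rule: less_induct)
  case less
  consider "odd (x + y)" | "x = 0 \<and> y = 0" | "even (x + y)" "\<not> (x = 0 \<and> y = 0)" by blast
  then show ?case
  proof cases
    case 1
    then show ?thesis by (rule arrows_legal_center)
  next
    case 2
    have 0: "arrows n 0 0 k = star (k + 7 * n)" for k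
    proof (cases "odd k")
      case True
      then show ?thesis by (simp add: arrows_def half_diagonal.simps)
    next
      case False
      have "k + 7 + 7 * (n + 7) = k + 7 * n + 8 * 7" by simp
      then have "star (k + 7 + 7 * (n + 7)) = star (k + 7 * n)"
        by (intro star_cong) (simp only: mod_mult_self2)
      with False show ?thesis by (simp add: arrows_def half_diagonal.simps)
    qed
    have "star (n + j + 7 * n) = star j" for j
      by (rule star_cong) (simp add: algebra_simps)
    from this this[of 0] have "legal_at (arrows n 0 0) n"
      using legal_star by (simp only: legal_at_def 0 add_0 add_0_right simp_thms)
    with 2 show ?thesis by blast
  next
    case 3
    define x' y' where "x' = (x + y) div 2" and "y' = (y - x) div 2"
    have ab: "x' - y' = x" "x' + y' = y" using 3(1) unfolding x'_def y'_def by presburger+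
    have "x\<^sup>2 + y\<^sup>2 = 2 * (x'\<^sup>2 + y'\<^sup>2)"
      unfolding ab[symmetric] by (simp add: power2_eq_square algebra_simps)
    moreover have pos: "x\<^sup>2 + y\<^sup>2 > 0" using 3(2) by (simp add: sum_power2_gt_zero_iff)
    moreover have "t < s" if "s = 2 * t" "0 < s" for s t :: int using that by linarith
    ultimately have "x'\<^sup>2 + y'\<^sup>2 < x\<^sup>2 + y\<^sup>2" by blast
    then have "nat (x'\<^sup>2 + y'\<^sup>2) < nat (x\<^sup>2 + y\<^sup>2)" using pos by simp
    from less.hyps[OF this, of "n + 7"] obtain m where "legal_at (arrows (n + 7) x' y') m" ..
    then have "legal_at (\<lambda>k. arrows (n + 7) x' y' (k + 7)) (Suc m)"
      by (rule legal_at_7) (rule arrows_cong, simp_all)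
    moreover have "arrows n x y = (\<lambda>k. arrows (n + 7) x' y' (k + 7))"
      unfolding x'_def y'_def using arrows_decompose[OF 3(1)] by blast
    ultimately show ?thesis by auto
  qed
qed

lemma coherent_arrows: "coherent (arrows n) 0"
proof
  fix x y k
  show "arrows n x y (k + 8) = arrows n x y k" by (rule arrows_cong) simp_all
  show "\<exists>m. legal_at (arrows n x y) m" by (rule arrows_legal)
  show "arrows n (x + dx k) (y + dy k) (k + 4) = flip (arrows n x y k)" if "even k \<or> even (x + y + 0)"
    using that arrows_side[of k] arrows_axis[of k x y] by (cases "even k") simp_all
  show "fst (arrows n x y k)" if "odd k" "odd (x + y + 0)" using that by (simp add: arrows_diagonal)
  show "snd (arrows n (x + dx k) (y + dy k) (k + 4)) \<noteq> snd (arrows n x y k)" if "odd k"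
    "odd (x + y + 0)"
    using that arrows_diagonal_hue by simp
qed

section \<open>Directions and corners in the plane\<close>

definition dir :: "nat \<Rightarrow> complex" where
  "dir k = cis (real k * pi / 4)"

definition dvec :: "nat \<Rightarrow> complex" where
  "dvec k = Complex (real_of_int (dx k)) (real_of_int (dy k))"

lemma dir_add: "dir (j + k) = dir j * dir k"
  by (simp add: dir_def cis_mult algebra_simps add_divide_distrib)

lemma dir_0: "dir 0 = 1" and dir_2: "dir 2 = \<i>"
  by (simp_all add: dir_def complex_eq_iff)

lemma dir_4: "dir 4 = - 1" using dir_add[of 2 2] by (simp add: dir_2)

lemma dir_8: "dir 8 = 1" using dir_add[of 4 4] by (simp add: dir_4)

lemma norm_dir [simp]: "norm (dir k) = 1" by (simp add: dir_def)

lemma dir_nonzero [simp]: "dir k \<noteq> 0" by (simp add: dir_def)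

lemma dir_eq_iff: "dir j = dir k \<longleftrightarrow> j mod 8 = k mod 8"
proof -
  have mod: "dir k = dir (k mod 8)" for k
    by (rule period8_mod) (simp add: dir_add dir_8)
  \<comment> \<open>The fourth power of \<open>dir m\<close> is \<open>1\<close> or
    \<open>- 1\<close> according to the parity of \<open>m\<close>, which excludes odd
    \<open>m\<close>; the remaining values are explicit.\<close>
  have one: "m = 0" if "dir m = 1" "m < 8" for m
  proof (rule ccontr)
    assume m: "m \<noteq> 0"
    have "dir (m + m + m + m) = 1" by (simp add: dir_add that)
    moreover have "dir (m + m + m + m) = (if even m then 1 else - 1)"
    proof -
      have "dir (4 * m) = (- 1) ^ m" for m
        by (induction m) (simp_all add: dir_0 dir_add dir_4)
      moreover have "m + m + m + m = 4 * m" by simp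
      ultimately show ?thesis by (simp only: minus_one_power_iff)
    qed
    ultimately have "even m" by (auto split: if_splits)
    with m that(2) have "m \<in> {2, 4, 6}" by (auto elim!: evenE)
    moreover have "dir 6 = - \<i>" using dir_add[of 4 2] by (simp add: dir_4 dir_2)
    ultimately show False using that(1) by (auto simp: dir_2 dir_4 complex_eq_iff)
  qed
  show ?thesis
  proof
    assume "dir j = dir k"
    then have "dir (j mod 8) = dir (k mod 8)" using mod by metis
    moreover have "p = q" if "dir p = dir q" "p < 8" "p \<le> q" "q < 8" for p q
    proof -
      have "dir p * dir (q - p) = dir p" using dir_add[of p "q - p"] that by simp
      then have "q - p = 0" using one[of "q - p"] that by simp
      with that show ?thesis by simp
    qed
    ultimately show "j mod 8 = k mod 8"
      by (metis linear mod_less_divisor zero_less_numeral)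
  next
    assume "j mod 8 = k mod 8"
    then show "dir j = dir k" using mod by metis
  qed
qed

lemma dvec_add_2: "dvec (k + 2) = \<i> * dvec k"
  by (simp add: dvec_def complex_eq_iff d_add_2 del: add_2_eq_Suc')

lemma dvec_add_4: "dvec (k + 4) = - dvec k" and dvec_add_8: "dvec (k + 8) = dvec k"
  by (simp_all add: dvec_def complex_eq_iff)

lemma dvec_cong: "j mod 8 = k mod 8 \<Longrightarrow> dvec j = dvec k"
  unfolding dvec_def using dx_cong dy_cong by metis

lemma dvec_eq: "dvec k = of_real (if even k then 1 else sqrt 2) * dir k"
proof (induction k rule: induct_nat_012)
  case 0
  then show ?case by (simp add: dvec_def dir_0 dx_def dy_def complex_eq_iff)
next
  case 1
  have d: "dir (Suc 0) = Complex (sqrt 2 / 2) (sqrt 2 / 2)"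
    by (simp add: dir_def complex_eq_iff cos_45 sin_45)
  show ?case unfolding d by (simp add: dvec_def dx_def dy_def complex_eq_iff)
next
  case (ge2 n)
  then show ?case using dvec_add_2[of n] dir_add[of n 2] by (simp add: dir_2)
qed

lemma sgn_dvec: "sgn (dvec k) = dir k" "sgn (dvec k / 2) = dir k"
proof -
  have "sgn (of_real r * dir k) = dir k" if "r > 0" for r
    using that by (simp add: sgn_mult sgn_of_real) (simp add: sgn_div_norm)
  from this[of "if even k then 1 else sqrt 2"] this[of "(if even k then 1 else sqrt 2) / 2"]
  show "sgn (dvec k) = dir k" "sgn (dvec k / 2) = dir k"
    by (simp_all add: dvec_eq split: if_splits)
qed

lemma dvec_odd_add:
  assumes "odd k"
  shows "dvec k + dvec (k + 2) = 2 * dvec (k + 1)" "dvec (k + 2) - dvec k = 2 * dvec (k + 3)"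
proof -
  have "dvec (k + 2) = Complex (- dy k) (dx k)"
    by (simp add: dvec_def d_add_2 del: add_2_eq_Suc')
  then show 1: "dvec k + dvec (k + 2) = 2 * dvec (k + 1)"
    using d_odd_Suc[OF assms] by (simp add: dvec_def complex_eq_iff)
  have "dvec (k + 3) = \<i> * dvec (k + 1)" using dvec_add_2[of "k + 1"] by (simp add: numeral_3_eq_3)
  then have "2 * dvec (k + 3) = \<i> * (dvec k + dvec (k + 2))" unfolding 1 by simp
  also have "\<dots> = dvec (k + 2) - dvec k"
    unfolding dvec_add_2 by (simp add: algebra_simps)
  finally show "dvec (k + 2) - dvec k = 2 * dvec (k + 3)" by simp
qed

text \<open>Source of the offsets used below: corner \<open>j\<close> lies in direction
  \<open>2 * j + 1\<close> from the centre, so from that corner the centre lies in direction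
  \<open>2 * j + 5\<close> and the next corner in direction \<open>2 * j + 4\<close>.\<close>

lemma corner_eq: "corner z j = z + dvec (2 * j + 1) / 2"
proof -
  have "\<i> ^ j * Complex (1/2) (1/2) = dvec (2 * j + 1) / 2"
  proof (induction j)
    case 0
    then show ?case by (simp add: dvec_def complex_eq_iff dx_def dy_def)
  next
    case (Suc j)
    then show ?case using dvec_add_2[of "2 * j + 1"] by (simp add: mult.assoc)
  qed
  then show ?thesis by (simp add: corner_def)
qed

lemma corner_cong: "j mod 4 = k mod 4 \<Longrightarrow> corner z j = corner z k"
proof -
  assume "j mod 4 = k mod 4"
  then have "2 * j mod 8 = 2 * k mod 8" using mult_mod_right[of 2 j 4] mult_mod_right[of 2 k 4] by simp
  then have "(2 * j + 1) mod 8 = (2 * k + 1) mod 8" by (rule mod_add_cong) simp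
  then show ?thesis unfolding corner_eq by (simp only: dvec_cong[of "2 * j + 1" "2 * k + 1"])
qed

lemma corner_add_2: "corner z (j + 2) = z - dvec (2 * j + 1) / 2"
proof -
  have "2 * (j + 2) + 1 = 2 * j + 1 + 4" by simp
  then show ?thesis unfolding corner_eq by (simp only: dvec_add_4) simp
qed

lemma corner_Suc: "corner z (Suc j) = corner z j + dvec (2 * j + 4)"
proof -
  have "2 * Suc j + 1 = 2 * j + 1 + 2" "2 * j + 4 = 2 * j + 1 + 3" by simp_all
  moreover have "dvec (2 * j + 1 + 2) = dvec (2 * j + 1) + 2 * dvec (2 * j + 1 + 3)"
    using dvec_odd_add(2)[of "2 * j + 1"] by (simp add: diff_eq_eq add.commute)
  ultimately show ?thesis unfolding corner_eq by (simp only: add_divide_distrib) simp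
qed

lemma corner_0: "corner z 0 = z + Complex (1/2) (1/2)" and corner_2: "corner z 2 = z - Complex (1/2) (1/2)"
  by (simp_all add: corner_def power2_eq_square complex_eq_iff)

lemma in_square_interior:
  "p \<in> interior (square z) \<longleftrightarrow> \<bar>Re (p - z)\<bar> < 1/2 \<and> \<bar>Im (p - z)\<bar> < 1/2"
  unfolding square_def interior_cbox in_box_complex_iff corner_0 corner_2 abs_less_iff
  by auto

lemma in_square:
  "p \<in> square z \<longleftrightarrow> \<bar>Re (p - z)\<bar> \<le> 1/2 \<and> \<bar>Im (p - z)\<bar> \<le> 1/2"
  unfolding square_def in_cbox_complex_iff corner_0 corner_2 abs_le_iff
  by auto

section \<open>Correct tilings are not periodic\<close>

text \<open>Reduces an arrow at \<open>v\<close> to a direction and a pair \<open>(b, c)\<close> as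
  in a coherent pattern. It is a relation, since existence and uniqueness of the pair come only from
  legality of the crossing.\<close>

definition incident :: "tile set \<Rightarrow> complex \<Rightarrow> nat \<Rightarrow> bool \<Rightarrow> color \<Rightarrow> bool" where
  "incident T v k b c \<longleftrightarrow>
    (\<exists>\<alpha>\<in>crossing T v. hue \<alpha> = c \<and> (if b then leaves v (dir k) \<alpha> else enters v (dir k) \<alpha>))"

lemma incident_cong: "j mod 8 = k mod 8 \<Longrightarrow> incident T v j b c \<longleftrightarrow> incident T v k b c"
  using dir_eq_iff[of j k] unfolding incident_def by simp

lemma incidentI:
  assumes "t \<in> T" "\<alpha> \<in> tile_arrows t" "hue \<alpha> = c" "0 < r"
  shows "tail \<alpha> = v \<Longrightarrow> head \<alpha> = v + of_real r * dvec k \<Longrightarrow> incident T v k True c"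
    and "head \<alpha> = v \<Longrightarrow> tail \<alpha> = v + of_real r * dvec k \<Longrightarrow> incident T v k False c"
  using assms unfolding incident_def crossing_def
  by (auto simp: leaves_def enters_def sgn_mult sgn_of_real sgn_dvec intro!: bexI[of _ \<alpha>])

lemma square_tileE:
  assumes "square_tile t"
  obtains s a c h\<^sub>1 h\<^sub>2 col where
    "sides t = s ` {..<4}"
    "\<forall>j<4. (tail (s j), head (s j)) \<in> {(corner (center t) j, corner (center t) (Suc j)),
       (corner (center t) (Suc j), corner (center t) j)}"
    "axis t = Arrow (corner (center t) a) (corner (center t) (a + 2)) c"
    "half_diagonals t = {Arrow (corner (center t) (a + 1)) (center t) h\<^sub>1,
       Arrow (corner (center t) (a + 3)) (center t) h\<^sub>2}"
    "h\<^sub>1 \<noteq> h\<^sub>2"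
    "triangles t = (\<lambda>j. (triangle (center t) j, col j)) ` {a..<a + 4}"
    "\<forall>j\<in>{a + 1, a + 3}. col (j - 1) = Red \<and> col j = Green"
proof -
  from assms[unfolded square_tile_def] show ?thesis
    by (elim exE conjE, hypsubst) (rule that; assumption)
qed

lemma square_tile_arrows:
  assumes "square_tile t" "\<alpha> \<in> tile_arrows t"
  obtains j where "tail \<alpha> = corner (center t) j" "head \<alpha> = corner (center t) (Suc j)"
  | j where "head \<alpha> = corner (center t) j" "tail \<alpha> = corner (center t) (Suc j)"
  | j where "tail \<alpha> = corner (center t) j" "head \<alpha> = center t"
  | j where "head \<alpha> = corner (center t) j" "tail \<alpha> = center t"
proof -
  obtain s a c h\<^sub>1 h\<^sub>2 col where t:
    "sides t = s ` {..<4}"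
    "\<forall>j<4. (tail (s j), head (s j)) \<in> {(corner (center t) j, corner (center t) (Suc j)),
       (corner (center t) (Suc j), corner (center t) j)}"
    "axis t = Arrow (corner (center t) a) (corner (center t) (a + 2)) c"
    "half_diagonals t = {Arrow (corner (center t) (a + 1)) (center t) h\<^sub>1,
       Arrow (corner (center t) (a + 3)) (center t) h\<^sub>2}"
    by (rule square_tileE[OF assms(1)])
  from assms(2) consider "\<alpha> \<in> sides t" | "\<alpha> \<in> half_diagonals t"
    | "\<alpha> = Arrow (tail (axis t)) (center t) (hue (axis t))"
    | "\<alpha> = Arrow (center t) (head (axis t)) (hue (axis t))"
    unfolding tile_arrows_def by blast
  then show ?thesis
  proof cases
    case 1
    then obtain j where "j < 4" "\<alpha> = s j" using t(1) by auto
    with t(2) that(1,2) show ?thesis by blast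
  next
    case 2
    then show ?thesis using t(4) that(3) by auto
  next
    case 3
    then show ?thesis using t(3) that(3) by auto
  next
    case 4
    then show ?thesis using t(3) that(4) by auto
  qed
qed

lemma mod4_double: "i mod 4 = j mod 4 \<Longrightarrow> (2 * i + n) mod 8 = (2 * j + n) mod (8::nat)"
proof -
  assume "i mod 4 = j mod 4"
  then have "2 * i mod 8 = 2 * j mod 8" using mult_mod_right[of 2 i 4] mult_mod_right[of 2 j 4] by simp
  then show ?thesis by (rule mod_add_cong) simp
qed

lemma tile_side_incident:
  assumes t: "t \<in> T" "square_tile t"
  shows "\<exists>b c. incident T (corner (center t) j) (2 * j + 4) b c \<and>
    incident T (corner (center t) (Suc j)) (2 * j) (\<not> b) c"
proof -
  define z where "z = center t"
  obtain s where s: "sides t = s ` {..<4}"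
    "\<forall>j<4. (tail (s j), head (s j)) \<in> {(corner z j, corner z (Suc j)), (corner z (Suc j), corner z j)}"
    unfolding z_def by (rule square_tileE[OF t(2)])
  define i where "i = j mod 4"
  have i: "i < 4" "i mod 4 = j mod 4" "Suc i mod 4 = Suc j mod 4"
    by (simp_all add: i_def mod_Suc_eq)
  have \<alpha>: "s i \<in> tile_arrows t" using i(1) s(1) by (auto simp: tile_arrows_def)
  have c: "corner z (Suc i) = corner z i + of_real 1 * dvec (2 * i + 4)"
    "corner z i = corner z (Suc i) + of_real 1 * dvec (2 * i)"
    using corner_Suc[of z i] dvec_add_4[of "2 * i"] by simp_all
  have "\<exists>b c. incident T (corner z i) (2 * i + 4) b c \<and> incident T (corner z (Suc i)) (2 * i) (\<not> b) c"
  proof -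
    from s(2) i(1) consider "tail (s i) = corner z i" "head (s i) = corner z (Suc i)"
      | "head (s i) = corner z i" "tail (s i) = corner z (Suc i)" by blast
    then show ?thesis
    proof cases
      case 1
      from incidentI(1)[OF t(1) \<alpha> refl zero_less_one 1(1) 1(2)[unfolded c(1)]]
        incidentI(2)[OF t(1) \<alpha> refl zero_less_one 1(2) 1(1)[unfolded c(2)]]
      show ?thesis by (intro exI[of _ True] exI[of _ "hue (s i)"]) simp
    next
      case 2
      from incidentI(2)[OF t(1) \<alpha> refl zero_less_one 2(1) 2(2)[unfolded c(1)]]
        incidentI(1)[OF t(1) \<alpha> refl zero_less_one 2(2) 2(1)[unfolded c(2)]]
      show ?thesis by (intro exI[of _ False] exI[of _ "hue (s i)"]) simp
    qed
  qed
  then show ?thesis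
    unfolding corner_cong[OF i(2)] corner_cong[OF i(3)]
      incident_cong[OF mod4_double[OF i(2)]] incident_cong[OF mod4_double[OF i(2), of 0, simplified]] z_def .
qed

lemma mod4_offset:
  fixes a j :: nat
  obtains r where "r < 4" "j mod 4 = (a + r) mod 4"
proof
  show "(j + 3 * a) mod 4 < 4" by simp
  have "(a + (j + 3 * a) mod 4) mod 4 = (a + (j + 3 * a)) mod 4" by (rule mod_add_right_eq)
  also have "a + (j + 3 * a) = j + 4 * a" by simp
  finally show "j mod 4 = (a + (j + 3 * a) mod 4) mod 4" by simp
qed

text \<open>\<open>a\<close> is the corner where the axis starts. Its parity governs both the
  diagonals and the colors of the triangles, and through the colors it can be compared between
  neighbouring tiles.\<close>

lemma tile_diagonals_incident:
  assumes t: "t \<in> T" "square_tile t"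
  obtains a where
    "\<And>j. even (j + a) \<Longrightarrow> \<exists>b c. incident T (corner (center t) j) (2 * j + 5) b c \<and>
       incident T (corner (center t) (j + 2)) (2 * j + 9) (\<not> b) c"
    "\<And>j. odd (j + a) \<Longrightarrow> \<exists>c d. incident T (corner (center t) j) (2 * j + 5) True c \<and>
       incident T (corner (center t) (j + 2)) (2 * j + 9) True d \<and> c \<noteq> d"
    "\<And>j. (triangle (center t) j, if even (j + a) then Red else Green) \<in> triangles t"
proof -
  define z where "z = center t"
  obtain a c h\<^sub>1 h\<^sub>2 col where ax: "axis t = Arrow (corner z a) (corner z (a + 2)) c"
    and h: "half_diagonals t = {Arrow (corner z (a + 1)) z h\<^sub>1, Arrow (corner z (a + 3)) z h\<^sub>2}"
      "h\<^sub>1 \<noteq> h\<^sub>2"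
    and tr: "triangles t = (\<lambda>j. (triangle z j, col j)) ` {a..<a + 4}"
    and col: "\<forall>j\<in>{a + 1, a + 3}. col (j - 1) = Red \<and> col j = Green"
    unfolding z_def by (rule square_tileE[OF t(2)])
  have to_center: "z = corner z j + of_real (1/2) * dvec (2 * j + 5)" for j
  proof -
    have "2 * j + 5 = 2 * j + 1 + 4" by simp
    then show ?thesis unfolding corner_eq by (simp only: dvec_add_4) simp
  qed
  have out: "incident T (corner z j) (2 * j + 5) True d" if "Arrow (corner z j) z d \<in> tile_arrows t" for j d
    using incidentI(1)[OF t(1) that, of d "1/2" "corner z j" "2 * j + 5"] to_center[of j] by simp
  have inn: "incident T (corner z j) (2 * j + 5) False d" if "Arrow z (corner z j) d \<in> tile_arrows t" for j d
    using incidentI(2)[OF t(1) that, of d "1/2" "corner z j" "2 * j + 5"] to_center[of j] by simp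
  have I: "incident T (corner z a) (2 * a + 5) True c"
    "incident T (corner z (a + 2)) (2 * (a + 2) + 5) False c"
    "incident T (corner z (a + 1)) (2 * (a + 1) + 5) True h\<^sub>1"
    "incident T (corner z (a + 3)) (2 * (a + 3) + 5) True h\<^sub>2"
    by (rule out inn; simp add: tile_arrows_def ax h flip: z_def)+
  have tcong: "triangle z i = triangle z j" if "i mod 4 = j mod 4" for i j
    using that by (simp add: triangle_def corner_cong[OF that] corner_cong[of "Suc i" "Suc j"] mod_Suc)
  have icong: "incident T (corner z j) (2 * j + 5) b d \<longleftrightarrow> incident T (corner z i) (2 * i + 5) b d"
    "incident T (corner z (j + 2)) (2 * j + 9) b d \<longleftrightarrow> incident T (corner z (i + 2)) (2 * (i + 2) + 5) b d"
    if "j mod 4 = i mod 4" for i j b d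
  proof -
    have "(j + 2) mod 4 = (i + 2) mod 4" using that by (intro mod_add_cong) simp_all
    moreover have "2 * (i + 2) + 5 = 2 * i + 9" by simp
    ultimately show "incident T (corner z j) (2 * j + 5) b d \<longleftrightarrow> incident T (corner z i) (2 * i + 5) b d"
      "incident T (corner z (j + 2)) (2 * j + 9) b d \<longleftrightarrow> incident T (corner z (i + 2)) (2 * (i + 2) + 5) b d"
      using corner_cong[of j i z, OF that] corner_cong[of "j + 2" "i + 2" z]
        incident_cong[OF mod4_double[OF that]] by metis+
  qed
  have wrap: "incident T (corner z (i + 4)) (2 * (i + 4) + 5) b d \<longleftrightarrow> incident T (corner z i) (2 * i + 5) b d" for i b d
    by (rule icong(1)) simp
  show ?thesis
  proof (rule that[of a, folded z_def])
    fix j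
    obtain r where r: "r < 4" "j mod 4 = (a + r) mod 4" by (rule mod4_offset)
    then have "even j \<longleftrightarrow> even (a + r)" by (metis dvd_mod_iff even_numeral)
    then have par: "even (j + a) \<longleftrightarrow> even r" by auto
    have r': "r = 0 \<or> r = 1 \<or> r = 2 \<or> r = 3" using r(1) by auto
    note ic = icong[OF r(2)]
    have eq: "a + 1 + 2 = a + 3" "a + 2 + 2 = a + 4" "a + 3 + 2 = a + 1 + 4" by simp_all
    show "\<exists>b c. incident T (corner z j) (2 * j + 5) b c \<and> incident T (corner z (j + 2)) (2 * j + 9) (\<not> b) c"
      if "even (j + a)"
    proof -
      from that par r' have "r = 0 \<or> r = 2" by auto
      then show ?thesis
      proof
        assume "r = 0"
        then show ?thesis unfolding ic
          using I(1,2) by (intro exI[of _ True] exI[of _ c]) simp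
      next
        assume "r = 2"
        then show ?thesis unfolding ic
          using I(1,2) wrap[of a] by (intro exI[of _ False] exI[of _ c]) (simp only: eq, simp)
      qed
    qed
    show "\<exists>c d. incident T (corner z j) (2 * j + 5) True c \<and>
       incident T (corner z (j + 2)) (2 * j + 9) True d \<and> c \<noteq> d" if "odd (j + a)"
    proof -
      from that par r' have "r = 1 \<or> r = 3" by auto
      then show ?thesis
      proof
        assume "r = 1"
        then show ?thesis unfolding ic
          using I(3,4) h(2) by (intro exI[of _ h\<^sub>1] exI[of _ h\<^sub>2]) (simp only: eq, simp)
      next
        assume "r = 3"
        then show ?thesis unfolding ic
          using I(3,4) h(2) wrap[of "a + 1"]
            by (intro exI[of _ h\<^sub>2] exI[of _ h\<^sub>1]) (simp only: eq, simp)
      qed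
    qed
    have "(triangle z (a + r), col (a + r)) \<in> triangles t" unfolding tr using r(1) by auto
    moreover have "col (a + r) = (if even (j + a) then Red else Green)"
      unfolding par using r' col by auto
    ultimately show "(triangle z j, if even (j + a) then Red else Green) \<in> triangles t"
      using tcong[OF r(2)] by simp
  qed
qed

text \<open>The unit vector in \<open>legal_crossing\<close> is arbitrary. One arrow known to lie in
  a direction \<open>dir j\<close> forces it to be a multiple of 45 degrees as well, and then the
  crossing becomes a function on the eight directions.\<close>

lemma legal_crossing_incident:
  assumes leg: "legal_crossing v (crossing T v)" and inc: "incident T v j b\<^sub>0 c\<^sub>0"
  obtains f m where "legal_at f m" "\<And>k. f (k + 8) = f k"
    "\<And>k b c. incident T v k b c \<longleftrightarrow> f k = (b, c)"
proof -
  obtain u d and \<alpha> :: "nat \<Rightarrow> arrow" where u: "norm u = 1" and d: "\<forall>k. d k = u * cis (real k * pi / 4)"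
    and A: "crossing T v = \<alpha> ` {..<8}"
    and ax: "leaves v (d 0) (\<alpha> 0)"
      "enters v (d 4) (\<alpha> 4)"
      "hue (\<alpha> 0) = hue (\<alpha> 4)"
    and perp: "enters v (d 2) (\<alpha> 2)"
      "enters v (d 6) (\<alpha> 6)"
      "hue (\<alpha> 2) \<noteq> hue (\<alpha> 6)"
    and out: "\<forall>k\<in>{1, 3, 5, 7}. leaves v (d k) (\<alpha> k)"
    and hues: "\<forall>k\<in>{2, 6}. hue (\<alpha> (k - 1)) = Red \<and> hue (\<alpha> (k + 1)) = Green"
    using leg[unfolded legal_crossing_def] by (elim exE conjE) (rule that; assumption)
  have d': "d k = u * dir k" for k using d by (simp add: dir_def)
  define lv where "lv i \<longleftrightarrow> i \<noteq> (2::nat) \<and> i \<noteq> 4 \<and> i \<noteq> 6" for i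
  have cases8: "i = 0 \<or> i = 1 \<or> i = 2 \<or> i = 3 \<or> i = 4 \<or> i = 5 \<or> i = 6 \<or> i = 7" if "i < 8" for i :: nat
    using that by auto
  have status: "if lv i then leaves v (d i) (\<alpha> i) else enters v (d i) (\<alpha> i)" if "i < 8" for i
    using cases8[OF that] ax perp out by (elim disjE) (simp_all add: lv_def)
  have nz: "d k \<noteq> 0" for k using u by (auto simp: d')
  \<comment> \<open>The directions are nonzero, so an arrow of the crossing cannot both enter and
    leave \<open>v\<close>.\<close>
  have same: "lv i = b \<and> d i = dir k"
    if "i < 8" "if b then leaves v (dir k) (\<alpha> i) else enters v (dir k) (\<alpha> i)" for i b k
    using status[OF that(1)] that(2) nz[of i] dir_nonzero[of k]
    by (cases b; cases "lv i") (auto simp: leaves_def enters_def simp del: dir_nonzero)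
  obtain i\<^sub>0 where i\<^sub>0: "i\<^sub>0 < 8" "d i\<^sub>0 = dir j"
    using inc same unfolding incident_def A by blast
  \<comment> \<open>Stands for \<open>j - i\<^sub>0\<close> modulo \<open>8\<close>.\<close>
  define m where "m = j + 7 * i\<^sub>0"
  have u': "u = dir m"
  proof -
    have "dir (8 * i\<^sub>0) = 1" using dir_eq_iff[of "8 * i\<^sub>0" 0] by (simp add: dir_0)
    moreover have "8 * i\<^sub>0 = i\<^sub>0 + 7 * i\<^sub>0" by simp
    ultimately have "dir i\<^sub>0 * dir (7 * i\<^sub>0) = 1" by (simp only: dir_add)
    then have "u = u * dir i\<^sub>0 * dir (7 * i\<^sub>0)" by (simp add: mult.assoc)
    also have "\<dots> = dir m" using i\<^sub>0(2) by (simp add: d' m_def dir_add)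
    finally show ?thesis .
  qed
  have dm: "d i = dir (m + i)" for i by (simp add: d' u' dir_add)
  define ix where "ix k = (k + 7 * m) mod 8" for k
  define f where "f k = (lv (ix k), hue (\<alpha> (ix k)))" for k
  have ix: "ix k < 8" "(m + ix k) mod 8 = k mod 8" for k
  proof -
    show "ix k < 8" by (simp add: ix_def)
    have "(m + ix k) mod 8 = (m + (k + 7 * m)) mod 8" unfolding ix_def by (rule mod_add_right_eq)
    also have "m + (k + 7 * m) = k + 8 * m" by simp
    finally show "(m + ix k) mod 8 = k mod 8" by simp
  qed
  have ixm: "ix (m + i) = i" if "i < 8" for i
  proof -
    have "m + i + 7 * m = i + 8 * m" by simp
    with that show ?thesis unfolding ix_def by simp
  qed
  have fm: "f (m + i) = (lv i, hue (\<alpha> i))" if "i < 8" for i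
    unfolding f_def ixm[OF that] ..
  have "legal_at f m"
    unfolding legal_at_def using fm[of 0] fm[of 1] fm[of 2] fm[of 3] fm[of 4] fm[of 5] fm[of 6] fm[of 7]
      ax(3) perp(3) hues by (simp add: lv_def flip_def)
  moreover have "f (k + 8) = f k" for k
  proof -
    have "k + 8 + 7 * m = k + 7 * m + 8" by simp
    then have "ix (k + 8) = ix k" unfolding ix_def by (simp only: mod_add_self2)
    then show ?thesis by (simp add: f_def)
  qed
  moreover have "incident T v k b c \<longleftrightarrow> f k = (b, c)" for k b c
  proof
    assume "incident T v k b c"
    then obtain i where i: "i < 8" "hue (\<alpha> i) = c"
      "if b then leaves v (dir k) (\<alpha> i) else enters v (dir k) (\<alpha> i)"
      unfolding incident_def A by blast
    have s: "lv i = b" "dir (m + i) = dir k" using same[OF i(1,3)] by (simp_all add: dm)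
    then have "(m + i) mod 8 = k mod 8" by (simp add: dir_eq_iff)
    then have "ix (m + i) = ix k" unfolding ix_def by (rule mod_add_cong) simp
    then have "i = ix k" using ixm[OF i(1)] by simp
    with s i show "f k = (b, c)" by (simp add: f_def)
  next
    assume "f k = (b, c)"
    then have "lv (ix k) = b" "hue (\<alpha> (ix k)) = c" by (simp_all add: f_def)
    moreover have "d (ix k) = dir k" by (simp add: dm dir_eq_iff ix)
    moreover have "\<alpha> (ix k) \<in> crossing T v" using A ix(1) by simp
    ultimately show "incident T v k b c"
      unfolding incident_def using status[OF ix(1)[of k]] by (intro bexI[of _ "\<alpha> (ix k)"]) auto
  qed
  ultimately show ?thesis by (rule that)
qed

text \<open>The unit square in diagonal direction \<open>k\<close> from a vertex has its south-west
  corner displaced by these two halves, and the vertex is its corner \<open>(k + 3) div 2\<close>.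
  This converts the parity of corner numbers into the parity of vertices.\<close>

lemma half_step_parity:
  assumes "odd k"
  shows "even ((dx k - 1) div 2 + (dy k - 1) div 2) \<longleftrightarrow> even ((k + 3) div 2)"
proof -
  have "even ((k + 3) div 2) \<longleftrightarrow> k mod 4 = 1" using assms by presburger
  moreover have "k mod 4 = (k mod 8) mod 4" by (simp add: mod_mod_cancel)
  ultimately show ?thesis using assms
    by (cases rule: mod8_cases[of k])
       (simp_all add: dx_mod[of k] dy_mod[of k] parity_mod8[of k], simp_all add: dx_def dy_def)
qed

section \<open>The tiles of a correct tiling lie on a lattice, with perpendicular axes in
  neighbours\<close>

locale tiling =
  fixes T :: "tile set"
  assumes correct: "correct_tiling T"
begin

lemma square_member: "t \<in> T \<Longrightarrow> square_tile t"
  using correct by (simp add: correct_tiling_def tiles_plane_def)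

lemma center_unique:
  assumes "t \<in> T"
    "t' \<in> T"
    "\<bar>Re (center t - center t')\<bar> < 1"
    "\<bar>Im (center t - center t')\<bar> < 1"
  shows "t = t'"
proof (rule ccontr)
  assume "t \<noteq> t'"
  then have "interior (square (center t)) \<inter> interior (square (center t')) = {}"
    using correct assms(1,2) by (simp add: correct_tiling_def tiles_plane_def)
  moreover define p where "p = (center t + center t') / 2"
  have "p \<in> interior (square (center t))" "p \<in> interior (square (center t'))"
    unfolding in_square_interior using assms(3,4)
      by (simp_all add: p_def abs_if field_simps split: if_splits)
  ultimately show False by blast
qed

lemma corner_arrows:
  assumes "t \<in> T"
  obtains f m where "legal_at f m" "\<And>k. f (k + 8) = f k"
    "\<And>k b c. incident T (corner (center t) j) k b c \<longleftrightarrow> f k = (b, c)"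
proof -
  have "legal_crossing (corner (center t) j) (crossing T (corner (center t) j))"
    using correct assms by (simp add: correct_tiling_def)
  moreover obtain b c where "incident T (corner (center t) j) (2 * j + 4) b c"
    using tile_side_incident[OF assms square_member[OF assms]] by blast
  ultimately show ?thesis using that by (rule legal_crossing_incident)
qed

text \<open>The eight arrows of a legal crossing come from tiles, so each of the four diagonal directions at a
  corner contains the centre of a tile.  This already forces the tiles onto a lattice.\<close>

lemma tile_around_corner:
  assumes t: "t \<in> T" and k: "odd k"
  obtains t' where "t' \<in> T" "center t' = corner (center t) j + dvec k / 2"
proof -
  define v where "v = corner (center t) j"
  obtain f m where "\<And>k b c. incident T v k b c \<longleftrightarrow> f k = (b, c)"
    unfolding v_def using corner_arrows[OF t] by metis
  then have "incident T v k (fst (f k)) (snd (f k))" by simp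
  then obtain \<alpha> t' where t': "t' \<in> T" "\<alpha> \<in> tile_arrows t'"
    and \<alpha>: "leaves v (dir k) \<alpha> \<or> enters v (dir k) \<alpha>"
    unfolding incident_def crossing_def by (auto split: if_splits)
  define z where "z = center t'"
  have not_side: False if "dir k = sgn (dvec l)" "even l" for l
    using that k parity_mod8[of k] parity_mod8[of l] by (simp add: sgn_dvec dir_eq_iff)
  \<comment> \<open>The centres of \<open>t\<close> and \<open>t'\<close> would differ by one half
    in each coordinate, so the interiors of the two squares would overlap.\<close>
  have not_center: False if "v = z"
  proof -
    have "center t' = center t + dvec (2 * j + 1) / 2" using that by (simp add: v_def z_def corner_eq)
    moreover have "\<bar>Re (dvec (2 * j + 1))\<bar> = 1" "\<bar>Im (dvec (2 * j + 1))\<bar> = 1"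
      using abs_d_odd[of "2 * j + 1"] by (simp_all add: dvec_def flip: of_int_abs)
    ultimately have "\<bar>Re (center t' - center t)\<bar> < 1"
      "\<bar>Im (center t' - center t)\<bar> < 1"
      "center t' \<noteq> center t"
      by auto
    then show False using center_unique[OF t'(1) t] by auto
  qed
  have at_corner: "center t' = v + dvec k / 2" if "v = corner z i" "dir k = sgn (z - corner z i)" for i
  proof -
    have "2 * i + 5 = 2 * i + 1 + 4" by simp
    then have e: "z - corner z i = dvec (2 * i + 5) / 2"
      unfolding corner_eq by (simp only: dvec_add_4) simp
    have "dir k = dir (2 * i + 5)" using that(2) unfolding e sgn_dvec .
    then have "dvec k = dvec (2 * i + 5)" by (intro dvec_cong) (simp add: dir_eq_iff)
    then have "z - v = dvec k / 2" using e that(1) by simp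
    then show ?thesis unfolding z_def by (metis add.commute diff_add_cancel)
  qed
  have side: "corner z (Suc i) - corner z i = dvec (2 * i + 4)"
    "corner z i - corner z (Suc i) = dvec (2 * i)" for i
    using corner_Suc[of z i] dvec_add_4[of "2 * i"] by simp_all
  have "center t' = v + dvec k / 2"
    using square_member[OF t'(1)] t'(2)
  proof (cases rule: square_tile_arrows[folded z_def])
    case (1 i)
    from 1[folded z_def] have "dir k = sgn (dvec (2 * i + 4)) \<or> dir k = sgn (dvec (2 * i))"
      using \<alpha> side[of i] by (auto simp: leaves_def enters_def)
    then show ?thesis using not_side[of "2 * i + 4"] not_side[of "2 * i"] by auto
  next
    case (2 i)
    from 2[folded z_def] have "dir k = sgn (dvec (2 * i + 4)) \<or> dir k = sgn (dvec (2 * i))"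
      using \<alpha> side[of i] by (auto simp: leaves_def enters_def)
    then show ?thesis using not_side[of "2 * i + 4"] not_side[of "2 * i"] by auto
  next
    case (3 i)
    from 3[folded z_def] \<alpha> not_center at_corner[of i] show ?thesis by (auto simp: leaves_def enters_def)
  next
    case (4 i)
    from 4[folded z_def] \<alpha> not_center at_corner[of i] show ?thesis by (auto simp: leaves_def enters_def)
  qed
  with t'(1) show ?thesis using that v_def by blast
qed

lemma adjacent_tile:
  assumes t: "t \<in> T"
  obtains t' where "t' \<in> T" "center t' = center t + dvec (2 * j + 2)"
proof -
  obtain t' where "t' \<in> T" "center t' = corner (center t) j + dvec (2 * j + 1 + 2) / 2"
    by (rule tile_around_corner[OF t, of "2 * j + 1 + 2"]) auto
  moreover have "dvec (2 * j + 1) / 2 + dvec (2 * j + 1 + 2) / 2 = dvec (2 * j + 2)"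
    using dvec_odd_add(1)[of "2 * j + 1"] by (simp flip: add_divide_distrib)
  ultimately show ?thesis using that by (simp add: corner_eq add.assoc)
qed

lemma lattice_tile:
  assumes t: "t \<in> T"
  shows "\<exists>t'\<in>T. center t' = center t + Complex (of_int x) (of_int y)"
proof -
  have step: "\<exists>t'\<in>T. center t' = z + Complex 1 0"
    "\<exists>t'\<in>T. center t' = z - Complex 1 0"
    "\<exists>t'\<in>T. center t' = z + Complex 0 1" "\<exists>t'\<in>T. center t' = z - Complex 0 1"
    if z: "\<exists>t\<in>T. center t = z" for z
  proof -
    from z obtain t where t: "t \<in> T" "center t = z" by blast
    have "\<exists>t'\<in>T. center t' = z + dvec (2 * j + 2)" for j
      using adjacent_tile[OF t(1), of j] t(2) by metis
    from this[of 0] this[of 1] this[of 2] this[of 3]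
    show "\<exists>t'\<in>T. center t' = z + Complex 1 0"
      "\<exists>t'\<in>T. center t' = z - Complex 1 0"
      "\<exists>t'\<in>T. center t' = z + Complex 0 1" "\<exists>t'\<in>T. center t' = z - Complex 0 1"
      by (simp_all add: dvec_def dx_def dy_def minus_complex.code plus_complex.code complex_eq_iff)
  qed
  have row: "\<exists>t'\<in>T. center t' = center t + Complex (of_int x) 0" for x
  proof (induction x rule: int_induct[where k = 0])
    case base
    show ?case using t by (auto simp: complex_eq_iff)
  next
    case (step1 i)
    have "center t + Complex (of_int (i + 1)) 0 = center t + Complex (of_int i) 0 + Complex 1 0"
      by (simp add: complex_eq_iff)
    then show ?case using step(1)[OF step1(2)] by (simp only:)
  next
    case (step2 i)
    have "center t + Complex (of_int (i - 1)) 0 = center t + Complex (of_int i) 0 - Complex 1 0"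
      by (simp add: complex_eq_iff)
    then show ?case using step(2)[OF step2(2)] by (simp only:)
  qed
  show ?thesis
  proof (induction y rule: int_induct[where k = 0])
    case base
    show ?case using row by simp
  next
    case (step1 i)
    have "center t + Complex (of_int x) (of_int (i + 1)) = center t + Complex (of_int x) (of_int i) + Complex 0 1"
      by (simp add: complex_eq_iff)
    then show ?case using step(3)[OF step1(2)] by (simp only:)
  next
    case (step2 i)
    have "center t + Complex (of_int x) (of_int (i - 1)) = center t + Complex (of_int x) (of_int i) - Complex 0 1"
      by (simp add: complex_eq_iff)
    then show ?case using step(4)[OF step2(2)] by (simp only:)
  qed
qed

text \<open>Triangle \<open>j\<close> of one tile and triangle \<open>j + 2\<close> of its neighbour
  share a side, so their colors differ; as \<open>j\<close> and \<open>j + 2\<close> have the same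
  parity, those of \<open>a\<close> and \<open>a'\<close> differ.\<close>

lemma adjacent_parity:
  assumes t: "t \<in> T" "t' \<in> T" and z: "center t' = center t + dvec (2 * j + 2)"
    and a: "\<And>j. (triangle (center t) j, if even (j + a) then Red else Green) \<in> triangles t"
    and a': "\<And>j. (triangle (center t') j, if even (j + a') then Red else Green) \<in> triangles t'"
  shows "even a' \<longleftrightarrow> odd a"
proof -
  let ?z = "center t" and ?z' = "center t'"
  have e: "2 * (j + 2) + 1 = 2 * j + 1 + 4"
    "2 * (j + 1) + 1 = 2 * j + 1 + 2"
    "2 * (j + 3) + 1 = 2 * j + 1 + 2 + 4"
    by simp_all
  have "2 * dvec (2 * j + 2) = dvec (2 * j + 1) + dvec (2 * j + 1 + 2)"
    using dvec_odd_add(1)[of "2 * j + 1"] by simp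
  then have d: "dvec (2 * j + 2) = dvec (2 * j + 1) / 2 + dvec (2 * j + 1 + 2) / 2"
    by (simp add: mult.commute flip: add_divide_distrib)
  have c: "corner ?z' (j + 2) = corner ?z (j + 1)" "corner ?z' (j + 3) = corner ?z j"
    unfolding corner_eq z d e dvec_add_4 by simp_all
  have nz: "dvec i \<noteq> 0" for i using sgn_dvec(1)[of i] dir_nonzero[of i] by auto
  have "corner ?z i \<noteq> ?z" for i by (simp add: corner_eq nz)
  then have "?z \<notin> triangle ?z' (j + 2)"
    using c nz[of "2 * j + 2"] z by (auto simp: triangle_def numeral_eq_Suc dest: sym)
  then have "triangle ?z j \<noteq> triangle ?z' (j + 2)" by (auto simp: triangle_def)
  moreover have "{corner ?z j, corner ?z (j + 1)} \<subseteq> triangle ?z j \<inter> triangle ?z' (j + 2)"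
    using c by (auto simp: triangle_def numeral_eq_Suc)
  moreover have "corner ?z j \<noteq> corner ?z (j + 1)" using corner_Suc[of ?z j] nz by simp
  ultimately have share: "triangle ?z j \<noteq> triangle ?z' (j + 2) \<and>
      (\<exists>p q. p \<noteq> q \<and> {p, q} \<subseteq> triangle ?z j \<inter> triangle ?z' (j + 2))"
        by blast
  have "\<forall>t\<in>T. \<forall>t'\<in>T. \<forall>(X, c)\<in>triangles t. \<forall>(Y, d)\<in>triangles t'.
       X \<noteq> Y \<and> (\<exists>p q. p \<noteq> q \<and> {p, q} \<subseteq> X \<inter> Y) \<longrightarrow> c \<noteq> d"
    using correct unfolding correct_tiling_def by (elim conjE)
  note bspec[OF bspec[OF bspec[OF bspec[OF this t(1)] t(2)] a, unfolded prod.case] a', unfolded prod.case]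
  from mp[OF this share]
  have "(if even (j + a) then Red else Green) \<noteq> (if even (j + 2 + a') then Red else Green)" .
  then show ?thesis by (auto split: if_splits)
qed

lemma incident_translate:
  assumes p: "translate_tile p ` T = T" and "incident T v k b c"
  shows "incident T (v + p) k b c"
proof -
  obtain \<alpha> t where t: "t \<in> T"
    "\<alpha> \<in> tile_arrows t"
    "tail \<alpha> = v \<or> head \<alpha> = v"
    "hue \<alpha> = c"
    and \<alpha>: "if b then leaves v (dir k) \<alpha> else enters v (dir k) \<alpha>"
    using assms(2) unfolding incident_def crossing_def by blast
  have "translate_tile p t \<in> T" using p t(1) by blast
  moreover have "translate_arrow p \<alpha> \<in> tile_arrows (translate_tile p t)"
    using t(2) unfolding tile_arrows_def translate_tile_def by (auto simp: translate_arrow_def)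
  ultimately show ?thesis
    unfolding incident_def crossing_def using t(3,4) \<alpha>
    by (intro bexI[of _ "translate_arrow p \<alpha>"])
       (auto simp: leaves_def enters_def translate_arrow_def split: if_splits)
qed

text \<open>The values of \<open>incident\<close> at the vertices form a coherent pattern, and a
  period of the tiling becomes an integer period of this pattern.\<close>

lemma aperiodic: "\<not> periodic T"
proof
  assume "periodic T"
  then obtain p where p: "p \<noteq> 0" "translate_tile p ` T = T" unfolding periodic_def by blast
  have "(\<Union>t\<in>T. square (center t)) = UNIV"
    using correct by (simp add: correct_tiling_def tiles_plane_def)
  then obtain t\<^sub>0 where t\<^sub>0: "t\<^sub>0 \<in> T" by blast
  define vert where "vert x y = corner (center t\<^sub>0) 2 + Complex (of_int x) (of_int y)" for x y
  have vert_d: "vert (x + dx k) (y + dy k) = vert x y + dvec k" for x y k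
    by (simp add: vert_def dvec_def complex_eq_iff)
  have "\<exists>t\<in>T. center t = vert x y + dvec 1 / 2" for x y
    using lattice_tile[OF t\<^sub>0, of x y]
    by (simp add: vert_def corner_2 dvec_def dx_def dy_def complex_eq_iff)
  then have "\<exists>t. t \<in> T \<and> center t = vert x y + dvec 1 / 2" for x y by blast
  then obtain tl where tl: "tl x y \<in> T" "center (tl x y) = vert x y + dvec 1 / 2" for x y by metis
  \<comment> \<open>\<open>tl x y\<close> is the tile with south-west corner
    \<open>vert x y\<close>; here the tile in diagonal direction \<open>k\<close> from a vertex is
    named by its own south-west corner.\<close>
  have tl_k: "center (tl (x + (dx k - 1) div 2) (y + (dy k - 1) div 2)) = vert x y + dvec k / 2"
    if "odd k" for x y k
  proof -
    have "2 * ((dx k - 1) div 2) = dx k - 1" "2 * ((dy k - 1) div 2) = dy k - 1"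
      using odd_d[OF that] by simp_all
    then have "2 * real_of_int ((dx k - 1) div 2) = dx k - 1"
      "2 * real_of_int ((dy k - 1) div 2) = dy k - 1"
      by (metis of_int_mult of_int_numeral of_int_diff of_int_1)+
    moreover have "dx (Suc 0) = 1" "dy (Suc 0) = 1" by (simp_all add: dx_def dy_def)
    ultimately show ?thesis unfolding tl
      by (simp add: vert_def dvec_def complex_eq_iff field_simps)
  qed
  have corner_k: "corner (vert x y + dvec k / 2) ((k + 3) div 2) = vert x y"
    "corner (vert x y + dvec k / 2) ((k + 3) div 2 + 2) = vert (x + dx k) (y + dy k)"
    "2 * ((k + 3) div 2) + 1 = k + 4" if "odd k" for x y k
  proof -
    show e: "2 * ((k + 3) div 2) + 1 = k + 4" using that by (auto elim!: oddE)
    show "corner (vert x y + dvec k / 2) ((k + 3) div 2) = vert x y"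
      "corner (vert x y + dvec k / 2) ((k + 3) div 2 + 2) = vert (x + dx k) (y + dy k)"
      unfolding corner_add_2 unfolding corner_eq e dvec_add_4 vert_d by simp_all
  qed
  have "\<exists>f. (\<exists>m. legal_at f m) \<and> (\<forall>k. f (k + 8) = f k) \<and>
     (\<forall>k b c. incident T (vert x y) k b c \<longleftrightarrow> f k = (b, c))" for x y
  proof -
    have "vert x y = corner (center (tl x y)) 2"
      unfolding tl using corner_k(1)[of 1 x y] by simp
    then show ?thesis using corner_arrows[OF tl(1)[of x y], of 2] by metis
  qed
  then obtain X where X: "\<exists>m. legal_at (X x y) m" "X x y (k + 8) = X x y k"
    "incident T (vert x y) k b c \<longleftrightarrow> X x y k = (b, c)" for x y k b c by metis
  have "\<exists>a. (\<forall>j. even (j + a) \<longrightarrow> (\<exists>b c. incident T (corner (center (tl x y)) j) (2 * j + 5) b c \<and>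
       incident T (corner (center (tl x y)) (j + 2)) (2 * j + 9) (\<not> b) c)) \<and>
    (\<forall>j. odd (j + a) \<longrightarrow> (\<exists>c d. incident T (corner (center (tl x y)) j) (2 * j + 5) True c \<and>
       incident T (corner (center (tl x y)) (j + 2)) (2 * j + 9) True d \<and> c \<noteq> d)) \<and>
    (\<forall>j. (triangle (center (tl x y)) j, if even (j + a) then Red else Green) \<in> triangles (tl x y))" for x y
    by (rule tile_diagonals_incident[OF tl(1) square_member[OF tl(1)], of x y]) blast
  then obtain a where
    a1: "even (j + a x y) \<Longrightarrow> \<exists>b c. incident T (corner (center (tl x y)) j) (2 * j + 5) b c \<and>
       incident T (corner (center (tl x y)) (j + 2)) (2 * j + 9) (\<not> b) c" and
    a2: "odd (j + a x y) \<Longrightarrow> \<exists>c d. incident T (corner (center (tl x y)) j) (2 * j + 5) True c \<and>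
       incident T (corner (center (tl x y)) (j + 2)) (2 * j + 9) True d \<and> c \<noteq> d" and
    a3: "(triangle (center (tl x y)) j, if even (j + a x y) then Red else Green) \<in> triangles (tl x y)"
    for x y j by metis
  have adj: "even (a (x + dx (2 * j + 2)) (y + dy (2 * j + 2))) \<longleftrightarrow> odd (a x y)" for x y j
    by (rule adjacent_parity[where j = j, OF tl(1) tl(1) _ a3 a3]) (simp only: tl vert_d, simp)
  have gx: "even (a (x + 1) y) \<longleftrightarrow> \<not> even (a x y)" and gy: "even (a x (y + 1)) \<longleftrightarrow> \<not> even (a x y)" for x y
    using adj[of x 3 y] adj[of x 0 y] by (simp_all add: dx_def dy_def)
  note alt = alternating[of "\<lambda>x y. even (a x y)", OF gx gy]
  \<comment> \<open>Corners \<open>0\<close> and \<open>2\<close> are the north-east and south-west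
    ones, so an even \<open>a x y\<close> means that the axis passes through
    \<open>vert x y\<close>.\<close>
  define e :: int where "e = (if even (a 0 0) then 0 else 1)"
  have par: "even (a x y) \<longleftrightarrow> even (x + y + e)" for x y using alt[of x y] by (auto simp: e_def)
  have "coherent X e"
  proof
    fix x y k
    show "X x y (k + 8) = X x y k" "\<exists>m. legal_at (X x y) m" by (rule X)+
    have even_flip: "X (x + dx k) (y + dy k) (k + 4) = flip (X x y k)" if "even k"
    proof -
      \<comment> \<open>Side \<open>k\<close> belongs to the tile in diagonal direction
        \<open>k + 1\<close>, which lies to its left; the vertex is corner \<open>j\<close> of that
        tile.\<close>
      define j where "j = (Suc k + 3) div 2"
      have "odd (Suc k)" using that by simp
      then obtain t where t: "t \<in> T" "center t = vert x y + dvec (Suc k) / 2"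
        using tl(1) tl_k by blast
      have j: "corner (center t) j = vert x y" "2 * j + 1 = k + 5"
        using corner_k(1)[of "Suc k" x y] corner_k(3)[of "Suc k"] that unfolding t(2) j_def by simp_all
      have j': "2 * j + 4 = k + 8" "2 * j = k + 4" using j(2) by simp_all
      have cs: "corner (center t) (Suc j) = vert (x + dx k) (y + dy k)"
        unfolding corner_Suc j(1) j'(1) vert_d dvec_add_8 ..
      obtain b c where "incident T (vert x y) (k + 8) b c"
        "incident T (vert (x + dx k) (y + dy k)) (k + 4) (\<not> b) c"
        using tile_side_incident[OF t(1) square_member[OF t(1)], of j] unfolding j(1) j'(1) cs unfolding j'(2)
          by blast
      then show ?thesis unfolding X(3) X(2) by (simp add: flip_def)
    qed
    define i j l where "i = x + (dx k - 1) div 2" and "j = y + (dy k - 1) div 2" and "l = (k + 3) div 2"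
    have c: "corner (center (tl i j)) l = vert x y"
      "corner (center (tl i j)) (l + 2) = vert (x + dx k) (y + dy k)"
      "2 * l + 5 = k + 8" "2 * l + 9 = k + 4 + 8" if "odd k"
      using corner_k(1,2)[OF that, of x y] corner_k(3)[OF that] unfolding i_def j_def l_def tl_k[OF that]
        by simp_all
    have pl: "even (l + a i j) \<longleftrightarrow> even (x + y + e)" if "odd k"
      using half_step_parity[OF that] par[of i j] unfolding i_def j_def l_def by auto
    show "X (x + dx k) (y + dy k) (k + 4) = flip (X x y k)" if "even k \<or> even (x + y + e)"
    proof (cases "even k")
      case True
      then show ?thesis by (rule even_flip)
    next
      case False
      then have "even (l + a i j)" using that pl by simp
      from a1[OF this] show ?thesis unfolding c[OF False] X(3) X(2) by (auto simp: flip_def)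
    qed
    assume k: "odd k" and o: "odd (x + y + e)"
    then have "odd (l + a i j)" using pl by simp
    from a2[OF this] obtain c d where "X x y k = (True, c)"
      "X (x + dx k) (y + dy k) (k + 4) = (True, d)"
      "c \<noteq> d"
      unfolding c[OF k] X(3) X(2) by blast
    then show "fst (X x y k)" "snd (X (x + dx k) (y + dy k) (k + 4)) \<noteq> snd (X x y k)" by auto
  qed
  moreover obtain m n where pmn: "p = Complex (of_int m) (of_int n)"
  proof -
    \<comment> \<open>The translate of \<open>t\<^sub>0\<close> and the lattice tile nearest to it
      have centres at most one half apart in each coordinate, so they coincide and \<open>p\<close>
      is integral.\<close>
    define m n where "m = round (Re p)" and "n = round (Im p)"
    have "translate_tile p t\<^sub>0 \<in> T" using p t\<^sub>0 by blast
    moreover obtain t where t: "t \<in> T" "center t = center t\<^sub>0 + Complex (of_int m) (of_int n)"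
      using lattice_tile[OF t\<^sub>0] by blast
    moreover have ct: "center (translate_tile p t\<^sub>0) = center t\<^sub>0 + p"
      by (simp add: translate_tile_def)
    moreover have "\<bar>real_of_int m - Re p\<bar> \<le> 1/2"
      "\<bar>real_of_int n - Im p\<bar> \<le> 1/2"
      unfolding m_def n_def by (rule of_int_round_abs_le)+
    ultimately have "t = translate_tile p t\<^sub>0" by (intro center_unique) simp_all
    with t ct have "p = Complex (of_int m) (of_int n)" by simp
    then show ?thesis by (rule that)
  qed
  moreover have "X (x + m) (y + n) = X x y" for x y
  proof
    fix k
    obtain b c where bc: "X x y k = (b, c)" by fastforce
    then have "incident T (vert x y) k b c" unfolding X(3) .
    from incident_translate[OF p(2) this] have "incident T (vert (x + m) (y + n)) k b c"
      unfolding vert_def pmn by (simp add: add.assoc plus_complex.code)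
    then show "X (x + m) (y + n) k = X x y k" unfolding X(3) bc .
  qed
  ultimately have "m = 0 \<and> n = 0" by (intro coherent_aperiodic)
  with pmn p(1) show False by (simp add: complex_eq_iff)
qed

end

section \<open>A correct tiling from a coherent pattern\<close>

lemma corner_1: "corner z 1 = z + Complex (- 1/2) (1/2)" and corner_3: "corner z 3 = z + Complex (1/2) (- 1/2)"
  and corner_4: "corner z 4 = corner z 0"
  by (simp_all add: corner_def power3_eq_cube power4_eq_xxxx complex_eq_iff)

lemma edge_iff:
  "w \<in> edge z 0 \<longleftrightarrow> Im (w - z) = 1/2 \<and> \<bar>Re (w - z)\<bar> \<le> 1/2"
  "w \<in> edge z 1 \<longleftrightarrow> Re (w - z) = - 1/2 \<and> \<bar>Im (w - z)\<bar> \<le> 1/2"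
  "w \<in> edge z 2 \<longleftrightarrow> Im (w - z) = - 1/2 \<and> \<bar>Re (w - z)\<bar> \<le> 1/2"
  "w \<in> edge z 3 \<longleftrightarrow> Re (w - z) = 1/2 \<and> \<bar>Im (w - z)\<bar> \<le> 1/2"
proof -
  have e: "edge z 0 = closed_segment (corner z 0) (corner z 1)"
    "edge z 1 = closed_segment (corner z 1) (corner z 2)"
    "edge z 2 = closed_segment (corner z 2) (corner z 3)"
      "edge z 3 = closed_segment (corner z 3) (corner z 0)"
    by (simp_all add: edge_def numeral_2_eq_2 numeral_3_eq_3 flip: corner_4) (simp add: numeral_eq_Suc)
  show "w \<in> edge z 0 \<longleftrightarrow> Im (w - z) = 1/2 \<and> \<bar>Re (w - z)\<bar> \<le> 1/2"
    "w \<in> edge z 1 \<longleftrightarrow> Re (w - z) = - 1/2 \<and> \<bar>Im (w - z)\<bar> \<le> 1/2"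
    "w \<in> edge z 2 \<longleftrightarrow> Im (w - z) = - 1/2 \<and> \<bar>Re (w - z)\<bar> \<le> 1/2"
    "w \<in> edge z 3 \<longleftrightarrow> Re (w - z) = 1/2 \<and> \<bar>Im (w - z)\<bar> \<le> 1/2"
    unfolding e corner_0 corner_1 corner_2 corner_3 abs_le_iff
    by (subst closed_segment_same_Im closed_segment_same_Re; force simp: closed_segment_eq_real_ivl)+
qed

text \<open>Only the eight neighbours of a square meet it; in each case the intersection is read off
  from the coordinates.\<close>

lemma squares_meet:
  fixes m n :: int
  assumes z': "z' = z + Complex (of_int m) (of_int n)" and mn: "\<not> (m = 0 \<and> n = 0)"
  defines "I \<equiv> square z \<inter> square z'"
  shows "I = {} \<or> (\<exists>j k. I = {corner z j} \<and> I = {corner z' k}) \<or> (\<exists>j k. I = edge z j \<and> I = edge z' k)"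
proof -
  have I: "w \<in> I \<longleftrightarrow> \<bar>Re (w - z)\<bar> \<le> 1/2 \<and> \<bar>Im (w - z)\<bar> \<le> 1/2 \<and>
      \<bar>Re (w - z) - of_int m\<bar> \<le> 1/2 \<and> \<bar>Im (w - z) - of_int n\<bar> \<le> 1/2" for w
    unfolding I_def by (auto simp: in_square z' diff_diff_eq)
  note I' = I[unfolded abs_le_iff] and edge' = edge_iff[unfolded abs_le_iff]
  have small: "I = {}" if "\<bar>m\<bar> \<ge> 2 \<or> \<bar>n\<bar> \<ge> 2"
  proof -
    from that have "\<bar>real_of_int m\<bar> \<ge> 2 \<or> \<bar>real_of_int n\<bar> \<ge> 2"
      by linarith
    then have "w \<notin> I" for w unfolding I by linarith
    then show ?thesis by blast
  qed
  consider "\<bar>m\<bar> \<ge> 2 \<or> \<bar>n\<bar> \<ge> 2" | "m = 1"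
    "n = 0" | "m = -1"
    "n = 0" | "m = 0"
    "n = 1" | "m = 0"
    "n = -1"
    | "m = 1" "n = 1" | "m = -1" "n = 1" | "m = 1" "n = -1" | "m = -1" "n = -1"
  proof -
    have "i = - 1 \<or> i = 0 \<or> i = 1" if "\<not> \<bar>i\<bar> \<ge> 2" for i :: int using that by linarith
    from this[of m] this[of n] show ?thesis using mn that by blast
  qed
  then show ?thesis
  proof cases
    case 1
    then show ?thesis using small by blast
  next
    case 2
    then have "I = edge z 3" "I = edge z' 1"
      by (auto simp: set_eq_iff I' z' edge' simp del: One_nat_def)
    then show ?thesis by blast
  next
    case 3
    then have "I = edge z 1" "I = edge z' 3"
      by (auto simp: set_eq_iff I' z' edge' simp del: One_nat_def)
    then show ?thesis by blast
  next
    case 4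
    then have "I = edge z 0" "I = edge z' 2"
      by (auto simp: set_eq_iff I' z' edge')
    then show ?thesis by blast
  next
    case 5
    then have "I = edge z 2" "I = edge z' 0"
      by (auto simp: set_eq_iff I' z' edge')
    then show ?thesis by blast
  next
    case 6
    then have "I = {corner z 0}" "I = {corner z' 2}"
      by (auto simp: set_eq_iff I' z' corner_0 corner_2 complex_eq_iff)
    then show ?thesis by blast
  next
    case 7
    then have "I = {corner z 1}" "I = {corner z' 3}"
      by (auto simp: set_eq_iff I' z' corner_1 corner_3 complex_eq_iff simp del: One_nat_def)
    then show ?thesis by blast
  next
    case 8
    then have "I = {corner z 3}" "I = {corner z' 1}"
      by (auto simp: set_eq_iff I' z' corner_1 corner_3 complex_eq_iff simp del: One_nat_def)
    then show ?thesis by blast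
  next
    case 9
    then have "I = {corner z 2}" "I = {corner z' 0}"
      by (auto simp: set_eq_iff I' z' corner_0 corner_2 complex_eq_iff)
    then show ?thesis by blast
  qed
qed

lemma dvec_eq_iff: "dvec j = dvec k \<longleftrightarrow> j mod 8 = k mod 8"
  using sgn_dvec(1)[of j] sgn_dvec(1)[of k] dir_eq_iff[of j k] dvec_cong[of j k] by metis

definition vert :: "int \<Rightarrow> int \<Rightarrow> complex" where
  "vert x y = Complex (of_int x) (of_int y)"

lemma vert_inject [simp]: "vert x y = vert x' y' \<longleftrightarrow> x = x' \<and> y = y'"
  by (simp add: vert_def)

lemma vert_add_d: "vert (x + dx k) (y + dy k) = vert x y + dvec k"
  by (simp add: vert_def dvec_def complex_eq_iff)

text \<open>\<open>(cx x j, cy y j)\<close> is the corner \<open>j\<close> of the unit square with south-west corner \<open>(x, y)\<close>.\<close>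

definition cx :: "int \<Rightarrow> nat \<Rightarrow> int" where
  "cx x j = x + 1 + (dx (2 * j + 1) - 1) div 2"

definition cy :: "int \<Rightarrow> nat \<Rightarrow> int" where
  "cy y j = y + 1 + (dy (2 * j + 1) - 1) div 2"

definition ctr :: "int \<Rightarrow> int \<Rightarrow> complex" where
  "ctr x y = Complex (of_int x + 1/2) (of_int y + 1/2)"

lemma vert_corner: "vert (cx x j) (cy y j) = corner (ctr x y) j"
proof -
  have "odd (dx (2 * j + 1)) \<and> odd (dy (2 * j + 1))" by (rule odd_d) simp
  then have "2 * ((dx (2 * j + 1) - 1) div 2) = dx (2 * j + 1) - 1"
    "2 * ((dy (2 * j + 1) - 1) div 2) = dy (2 * j + 1) - 1"
    by simp_all
  then have "2 * real_of_int ((dx (2 * j + 1) - 1) div 2) = dx (2 * j + 1) - 1"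
    "2 * real_of_int ((dy (2 * j + 1) - 1) div 2) = dy (2 * j + 1) - 1"
    by (metis of_int_mult of_int_numeral of_int_diff of_int_1)+
  then show ?thesis
    by (simp add: vert_def cx_def cy_def ctr_def corner_eq dvec_def complex_eq_iff field_simps)
qed

lemma corner_parity: "even (cx x j + cy y j) \<longleftrightarrow> even (x + y + int j)"
  using half_step_parity[of "2 * j + 1"] unfolding cx_def cy_def by auto

lemma corner_shift: "\<exists>x' y'. cx x' j = x \<and> cy y' j = y"
  by (intro exI[of _ "x - 1 - (dx (2 * j + 1) - 1) div 2"] exI[of _ "y - 1 - (dy (2 * j + 1) - 1) div 2"])
     (simp add: cx_def cy_def)

lemma c_add_2: "cx x (j + 2) = cx x j + dx (2 * j + 5)" "cy y (j + 2) = cy y j + dy (2 * j + 5)"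
proof -
  have e: "2 * j + 5 = 2 * j + 1 + 4" by simp
  have "vert (cx x (j + 2)) (cy y (j + 2)) = vert (cx x j + dx (2 * j + 5)) (cy y j + dy (2 * j + 5))" for x y
    unfolding vert_corner vert_add_d corner_add_2 unfolding corner_eq e dvec_add_4 by simp
  then show "cx x (j + 2) = cx x j + dx (2 * j + 5)" "cy y (j + 2) = cy y j + dy (2 * j + 5)" by simp_all
qed

lemma ctr_corner: "ctr x y = corner (ctr x y) j + of_real (1/2) * dvec (2 * j + 5)"
proof -
  have "2 * j + 5 = 2 * j + 1 + 4" by simp
  then show ?thesis unfolding corner_eq by (simp only: dvec_add_4) simp
qed

text \<open>The parity of \<open>x + y + j\<close> will be the color. Within one square, two
  triangles with two common vertices have consecutive numbers. In different squares they share a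
  side, so the squares are neighbours and \<open>j\<close>, \<open>k\<close> have equal
  parity.\<close>

lemma triangle_color:
  assumes "triangle (ctr x y) j \<noteq> triangle (ctr x' y') k" and pq: "p \<noteq> q"
    "{p, q} \<subseteq> triangle (ctr x y) j \<inter> triangle (ctr x' y') k"
  shows "even (x + y + int j) \<longleftrightarrow> odd (x' + y' + int k)"
proof -
  have ctr_vert: "ctr u v \<noteq> vert r s" for u v r s
  proof
    assume "ctr u v = vert r s"
    then have "2 * (real_of_int r - real_of_int u) = 1" by (simp add: ctr_def vert_def)
    then have "real_of_int (2 * (r - u)) = of_int 1" by simp
    then have "2 * (r - u) = 1" by (simp only: of_int_eq_iff)
    then show False by presburger
  qed
  then have cc: "ctr u v \<noteq> corner (ctr r s) i" for u v r s i
    by (metis vert_corner)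
  have tri: "triangle z i = {z, corner z i, corner z (Suc i)}" for z i by (simp add: triangle_def)
  \<comment> \<open>Twice the midpoint of the side: equating it for the two triangles locates the
    second square relative to the first.\<close>
  have sum: "corner z i + corner z (Suc i) = 2 * z + dvec (2 * i + 2)" for z i
  proof -
    have "2 * Suc i + 1 = 2 * i + 1 + 2" by simp
    moreover have "dvec (2 * i + 1) / 2 + dvec (2 * i + 1 + 2) / 2 = dvec (2 * i + 2)"
      using dvec_odd_add(1)[of "2 * i + 1"] by (simp flip: add_divide_distrib)
    ultimately show ?thesis unfolding corner_eq by (simp only:) (simp add: algebra_simps)
  qed
  have distinct: "corner z i \<noteq> corner z l" if "i mod 4 \<noteq> l mod 4" for z i l
  proof
    assume "corner z i = corner z l"
    then have "(2 * i + 1) mod 8 = (2 * l + 1) mod 8" by (simp add: corner_eq dvec_eq_iff)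
    then have "(2 * i + 1 + 7) mod 8 = (2 * l + 1 + 7) mod 8" by (rule mod_add_cong) simp
    then have "2 * i mod 8 = 2 * l mod 8" by simp
    then show False using that mult_mod_right[of 2 i 4] mult_mod_right[of 2 l 4] by simp
  qed
  show ?thesis
  proof (cases "x = x' \<and> y = y'")
    case True
    show ?thesis
    proof (cases "even (j + k)")
      case False
      then show ?thesis using True by auto
    next
      case even: True
      define z where "z = ctr x y"
      have S: "Suc j mod 4 = Suc k mod 4" if "j mod 4 = k mod 4" using that by (metis mod_Suc_eq)
      have "j mod 4 \<noteq> k mod 4"
        using assms(1) True corner_cong[of j k z] corner_cong[of "Suc j" "Suc k" z] S
        by (auto simp: tri z_def)
      moreover have "j mod 4 \<noteq> Suc k mod 4" "Suc j mod 4 \<noteq> k mod 4"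
      proof -
        have "even i \<longleftrightarrow> even (i mod 4)" for i :: nat by (simp add: dvd_mod_iff)
        then show "j mod 4 \<noteq> Suc k mod 4" "Suc j mod 4 \<noteq> k mod 4"
          using even by (metis even_Suc even_add)+
      qed
      moreover have "Suc j mod 4 \<noteq> Suc k mod 4"
      proof
        assume "Suc j mod 4 = Suc k mod 4"
        then have "(Suc j + 3) mod 4 = (Suc k + 3) mod 4" by (rule mod_add_cong) simp
        moreover have "Suc i + 3 = i + 4" for i by simp
        ultimately show False using \<open>j mod 4 \<noteq> k mod 4\<close> by (simp only: mod_add_self2)
      qed
      ultimately have "triangle z j \<inter> triangle z k \<subseteq> {z}"
        using distinct[of j k z] distinct[of j "Suc k" z] distinct[of "Suc j" k z] distinct[of "Suc j"
          "Suc k" z]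
        by (auto simp: tri)
      then show ?thesis using pq True by (auto simp: z_def)
    qed
  next
    case False
    then have "ctr x y \<noteq> ctr x' y'" by (simp add: ctr_def)
    then have "{p, q} \<subseteq> {corner (ctr x y) j, corner (ctr x y) (Suc j)}"
      "{p, q} \<subseteq> {corner (ctr x' y') k, corner (ctr x' y') (Suc k)}"
      using pq(2) cc[of x y x' y'] cc[of x' y' x y] by (auto simp: tri)
    then have "p + q = corner (ctr x y) j + corner (ctr x y) (Suc j)"
      "p + q = corner (ctr x' y') k + corner (ctr x' y') (Suc k)"
      using pq(1) by (auto simp: add.commute)
    then have "2 * ctr x y + dvec (2 * j + 2) = 2 * ctr x' y' + dvec (2 * k + 2)" unfolding sum by simp
    then have "real_of_int (2 * x + dx (2 * j + 2)) = of_int (2 * x' + dx (2 * k + 2))"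
      "real_of_int (2 * y + dy (2 * j + 2)) = of_int (2 * y' + dy (2 * k + 2))"
      by (simp_all add: ctr_def dvec_def complex_eq_iff)
    then have e: "2 * x + dx (2 * j + 2) = 2 * x' + dx (2 * k + 2)"
      "2 * y + dy (2 * j + 2) = 2 * y' + dy (2 * k + 2)" by (simp_all only: of_int_eq_iff)
    have d: "dx (2 * i + 2) = 0 \<and> \<bar>dy (2 * i + 2)\<bar> = 1 \<and> even i \<or>
        dy (2 * i + 2) = 0 \<and> \<bar>dx (2 * i + 2)\<bar> = 1 \<and> odd i" for i
    proof (induction i)
      case 0
      show ?case by (simp add: dx_def dy_def)
    next
      case (Suc i)
      have "2 * Suc i + 2 = 2 * i + 2 + 2" by simp
      then show ?case using Suc by (simp only: d_add_2) auto
    qed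
    have unit: "t = 1 \<or> t = - 1" if "\<bar>t\<bar> = 1" for t :: int using that by linarith
    from d[of j] show ?thesis
    proof (elim disjE conjE)
      assume j: "dx (2 * j + 2) = 0" "\<bar>dy (2 * j + 2)\<bar> = 1" "even j"
      from d[of k] show ?thesis
      proof (elim disjE conjE)
        assume k: "dx (2 * k + 2) = 0" "\<bar>dy (2 * k + 2)\<bar> = 1" "even k"
        then have "x = x'" using e(1) j(1) by simp
        moreover have "y' = y + 1 \<or> y' = y - 1"
          using unit[OF j(2)] unit[OF k(2)] e(2) False \<open>x = x'\<close> by auto
        ultimately show ?thesis using j(3) k(3) by auto
      next
        assume "dy (2 * k + 2) = 0"
        then show ?thesis using unit[OF j(2)] e(2) by presburger
      qed
    next
      assume j: "dy (2 * j + 2) = 0" "\<bar>dx (2 * j + 2)\<bar> = 1" "odd j"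
      from d[of k] show ?thesis
      proof (elim disjE conjE)
        assume "dx (2 * k + 2) = 0"
        then show ?thesis using unit[OF j(2)] e(1) by presburger
      next
        assume k: "dy (2 * k + 2) = 0" "\<bar>dx (2 * k + 2)\<bar> = 1" "odd k"
        then have "y = y'" using e(2) j(1) by simp
        moreover have "x' = x + 1 \<or> x' = x - 1"
          using unit[OF j(2)] unit[OF k(2)] e(1) False \<open>y = y'\<close> by auto
        ultimately show ?thesis using j(3) k(3) by auto
      qed
    qed
  qed
qed

section \<open>The tiling built from a coherent pattern\<close>

locale pattern = coherent X 0 for X
begin

text \<open>The factor \<open>1/2\<close> is due to \<open>dvec\<close>, which spans the whole
  diagonal of a square in odd directions.\<close>

definition arrow_at :: "int \<Rightarrow> int \<Rightarrow> nat \<Rightarrow> arrow" where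
  "arrow_at x y k =
    (let w = vert x y + of_real (if even k then 1 else 1/2) * dvec k in
     if fst (X x y k) then Arrow (vert x y) w (snd (X x y k)) else Arrow w (vert x y) (snd (X x y k)))"

text \<open>The half-diagonal at the corner \<open>j\<close>, seen from that corner.\<close>

definition spoke :: "int \<Rightarrow> int \<Rightarrow> nat \<Rightarrow> bool \<times> color" where
  "spoke x y j = X (cx x j) (cy y j) (2 * j + 5)"

text \<open>The corner where the axis starts.\<close>

definition origin :: "int \<Rightarrow> int \<Rightarrow> nat" where
  "origin x y = (let a = if even (x + y) then 0 else 1 in if fst (spoke x y a) then a else a + 2)"

definition tile_at :: "int \<Rightarrow> int \<Rightarrow> tile" where
  "tile_at x y = (let z = ctr x y; a = origin x y in
    \<lparr>center = z,
     sides = (\<lambda>j. arrow_at (cx x j) (cy y j) (2 * j + 4)) ` {..<4},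
     axis = Arrow (corner z a) (corner z (a + 2)) (snd (spoke x y a)),
     half_diagonals = {Arrow (corner z (a + 1)) z (snd (spoke x y (a + 1))),
       Arrow (corner z (a + 3)) z (snd (spoke x y (a + 3)))},
     triangles = (\<lambda>j. (triangle z j, if even (j + a) then Red else Green)) ` {a..<a + 4}\<rparr>)"

lemma tile_at_sel:
  "center (tile_at x y) = ctr x y"
  "sides (tile_at x y) = (\<lambda>j. arrow_at (cx x j) (cy y j) (2 * j + 4)) ` {..<4}"
  "axis (tile_at x y) = Arrow (corner (ctr x y) (origin x y)) (corner (ctr x y) (origin x y + 2)) (snd (spoke x y (origin x y)))"
  "half_diagonals (tile_at x y) =
    {Arrow (corner (ctr x y) (origin x y + 1)) (ctr x y) (snd (spoke x y (origin x y + 1))),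
     Arrow (corner (ctr x y) (origin x y + 3)) (ctr x y) (snd (spoke x y (origin x y + 3)))}"
  "triangles (tile_at x y) =
    (\<lambda>j. (triangle (ctr x y) j, if even (j + origin x y) then Red else Green)) ` {origin x y..<origin x y + 4}"
  by (simp_all add: tile_at_def Let_def)

definition tiles :: "tile set" where
  "tiles = {tile_at x y | x y. True}"

lemma X_cong: "j mod 8 = k mod 8 \<Longrightarrow> X x y j = X x y k"
  using period8_cong[of "X x y"] period by blast

lemma arrow_at_cong:
  assumes "j mod 8 = k mod 8"
  shows "arrow_at x y j = arrow_at x y k"
proof -
  have "even j \<longleftrightarrow> even k" using parity_mod8 assms by metis
  then show ?thesis using X_cong[OF assms] dvec_cong[OF assms] by (simp add: arrow_at_def Let_def)
qed

lemma spoke_add_2: "spoke x y (j + 2) = X (cx x j + dx (2 * j + 5)) (cy y j + dy (2 * j + 5)) (2 * j + 5 + 4)"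
proof -
  have "2 * (j + 2) + 5 = 2 * j + 5 + 4" by simp
  then show ?thesis unfolding spoke_def c_add_2 by (simp only:)
qed

lemma spoke_axis: "even (x + y + int j) \<Longrightarrow> spoke x y (j + 2) = flip (spoke x y j)"
  unfolding spoke_add_2 unfolding spoke_def using corner_parity[of x j y] by (intro ends_flip) simp

lemma spoke_leaves: "odd (x + y + int j) \<Longrightarrow> fst (spoke x y j)"
  unfolding spoke_def using corner_parity[of x j y] by (intro diagonal_leaves) simp_all

lemma spoke_hue: "odd (x + y + int j) \<Longrightarrow> snd (spoke x y (j + 2)) \<noteq> snd (spoke x y j)"
  unfolding spoke_add_2 unfolding spoke_def using corner_parity[of x j y]
    by (intro diagonal_hue) simp_all

lemma origin_parity: "even (origin x y) \<longleftrightarrow> even (x + y)"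
  by (simp add: origin_def Let_def)

lemma origin_leaves: "fst (spoke x y (origin x y))"
proof -
  define a :: nat where "a = (if even (x + y) then 0 else 1)"
  have "spoke x y (a + 2) = flip (spoke x y a)" by (rule spoke_axis) (simp add: a_def)
  then show ?thesis unfolding origin_def a_def[symmetric] Let_def by simp
qed

lemma arrow_at_spoke:
  "arrow_at (cx x j) (cy y j) (2 * j + 5) =
    (if fst (spoke x y j) then Arrow (corner (ctr x y) j) (ctr x y) (snd (spoke x y j))
     else Arrow (ctr x y) (corner (ctr x y) j) (snd (spoke x y j)))"
  using ctr_corner[of x y j] by (simp add: arrow_at_def spoke_def vert_corner)

lemma arrow_at_mod4:
  assumes "i mod 4 = j mod 4"
  shows "arrow_at (cx x i) (cy y i) (2 * i + n) = arrow_at (cx x j) (cy y j) (2 * j + n)"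
proof -
  have "vert (cx x i) (cy y i) = vert (cx x j) (cy y j)"
    unfolding vert_corner by (rule corner_cong[OF assms])
  then show ?thesis using arrow_at_cong[OF mod4_double[OF assms]] by simp
qed

text \<open>Letting \<open>j\<close> run over all natural numbers removes the starting corner of the
  axis: the arrows of a tile are simply those of the pattern at its corners.\<close>

lemma tile_arrows_tile_at:
  "tile_arrows (tile_at x y) =
    (\<Union>j. {arrow_at (cx x j) (cy y j) (2 * j + 4), arrow_at (cx x j) (cy y j) (2 * j + 5)})"
proof -
  define a where "a = origin x y"
  have o: "odd (x + y + int (a + 1))" "odd (x + y + int (a + 3))" "even (x + y + int a)"
    using origin_parity[of x y] by (simp_all add: a_def)
  have sp: "fst (spoke x y a)" "spoke x y (a + 2) = flip (spoke x y a)"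
    "fst (spoke x y (a + 1))" "fst (spoke x y (a + 3))"
    using origin_leaves[of x y] spoke_axis[OF o(3)] spoke_leaves[OF o(1)] spoke_leaves[OF o(2)]
    unfolding a_def by blast+
  define S where "S = (\<lambda>j. arrow_at (cx x j) (cy y j) (2 * j + 5))"
  have S: "S a = Arrow (corner (ctr x y) a) (ctr x y) (snd (spoke x y a))"
    "S (a + 2) = Arrow (ctr x y) (corner (ctr x y) (a + 2)) (snd (spoke x y a))"
    "S (a + 1) = Arrow (corner (ctr x y) (a + 1)) (ctr x y) (snd (spoke x y (a + 1)))"
    "S (a + 3) = Arrow (corner (ctr x y) (a + 3)) (ctr x y) (snd (spoke x y (a + 3)))"
    unfolding S_def arrow_at_spoke using sp by simp_all
  have "tile_arrows (tile_at x y) =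
     (\<lambda>j. arrow_at (cx x j) (cy y j) (2 * j + 4)) ` {..<4} \<union> {S (a + 1), S (a + 3)} \<union> {S a, S (a + 2)}"
    unfolding tile_arrows_def tile_at_sel a_def[symmetric] S by simp
  also have "(\<lambda>j. arrow_at (cx x j) (cy y j) (2 * j + 4)) ` {..<4} = range (\<lambda>j. arrow_at (cx x j) (cy y j) (2 * j + 4))"
  proof -
    have "arrow_at (cx x j) (cy y j) (2 * j + 4) \<in> (\<lambda>j. arrow_at (cx x j) (cy y j) (2 * j + 4)) ` {..<4}" for j
      using arrow_at_mod4[of j "j mod 4" x y 4] by (intro image_eqI[of _ _ "j mod 4"]) simp_all
    then show ?thesis by blast
  qed
  also have "\<dots> \<union> {S (a + 1), S (a + 3)} \<union> {S a, S (a + 2)} = \<dots> \<union> range S"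
  proof -
    have "S j \<in> {S a, S (a + 1), S (a + 2), S (a + 3)}" for j
    proof -
      obtain r where r: "r < 4" "j mod 4 = (a + r) mod 4" by (rule mod4_offset)
      have "S j = S (a + r)" unfolding S_def by (rule arrow_at_mod4[OF r(2)])
      moreover have "r = 0 \<or> r = 1 \<or> r = 2 \<or> r = 3" using r(1) by auto
      ultimately show ?thesis by auto
    qed
    then show ?thesis by blast
  qed
  finally show ?thesis unfolding S_def by blast
qed

lemma arrow_at_reverse:
  assumes "even k"
  shows "arrow_at (x + dx k) (y + dy k) (k + 4) = arrow_at x y k"
  using assms ends_flip[of k x y] by (simp add: arrow_at_def vert_add_d dvec_add_4 Let_def)

lemma arrow_at_in_tile:
  "arrow_at (cx x j) (cy y j) (2 * j + 4) \<in> tile_arrows (tile_at x y)"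
  "arrow_at (cx x j) (cy y j) (2 * j + 5) \<in> tile_arrows (tile_at x y)"
  unfolding tile_arrows_tile_at by (rule UN_I[of j, OF UNIV_I], simp)+

lemma tile_at_in_tiles: "tile_at x y \<in> tiles"
  unfolding tiles_def by blast

lemma all_arrows: "(\<Union>t\<in>tiles. tile_arrows t) = {arrow_at x y k | x y k. True}"
proof (intro subset_antisym subsetI)
  fix \<alpha> assume "\<alpha> \<in> (\<Union>t\<in>tiles. tile_arrows t)"
  then obtain x y where "\<alpha> \<in> tile_arrows (tile_at x y)" unfolding tiles_def by auto
  then obtain j where "\<alpha> \<in> {arrow_at (cx x j) (cy y j) (2 * j + 4), arrow_at (cx x j) (cy y j) (2 * j + 5)}"
    unfolding tile_arrows_tile_at by (rule UN_E)
  then show "\<alpha> \<in> {arrow_at x y k | x y k. True}" by blast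
next
  fix \<alpha> assume "\<alpha> \<in> {arrow_at x y k | x y k. True}"
  then obtain x y k where \<alpha>: "\<alpha> = arrow_at x y k" by blast
  \<comment> \<open>Chosen so that \<open>2 * j + 4\<close>, respectively \<open>2 * j + 5\<close>,
    is \<open>k + 8\<close>; the summand \<open>8\<close> keeps \<open>j\<close> a natural
    number.\<close>
  define j where "j = (if even k then (k + 4) div 2 else (k + 3) div 2)"
  obtain x' y' where xy: "cx x' j = x" "cy y' j = y" using corner_shift by blast
  have k8: "arrow_at x y (k + 8) = \<alpha>" unfolding \<alpha> by (rule arrow_at_cong) simp
  have "\<alpha> \<in> tile_arrows (tile_at x' y')"
  proof (cases "even k")
    case True
    then have "2 * j + 4 = k + 8" by (auto simp: j_def elim!: evenE)
    then show ?thesis using arrow_at_in_tile(1)[of x' j y'] unfolding xy by (simp only: k8)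
  next
    case False
    then have "2 * j + 5 = k + 8" by (auto simp: j_def elim!: oddE)
    then show ?thesis using arrow_at_in_tile(2)[of x' j y'] unfolding xy by (simp only: k8)
  qed
  then show "\<alpha> \<in> (\<Union>t\<in>tiles. tile_arrows t)" by (rule UN_I[OF tile_at_in_tiles])
qed

text \<open>An arrow based at another vertex can end here only if it is a side, which
  \<open>arrow_at_reverse\<close> reads from this end; the far end of a half-diagonal is a centre,
  with half-integral coordinates.\<close>

lemma crossing_tiles: "crossing tiles (vert x y) = arrow_at x y ` {..<8}"
proof -
  have 1: "\<alpha> \<in> range (arrow_at x y)" if "tail \<alpha> = vert x y \<or> head \<alpha> = vert x y"
    "\<alpha> = arrow_at x' y' k" for \<alpha> x' y' k
  proof (cases "vert x' y' = vert x y")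
    case True
    then show ?thesis using that(2) by simp
  next
    case False
    then have v: "vert x y = vert x' y' + of_real (if even k then 1 else 1/2) * dvec k"
      using that by (auto simp: arrow_at_def Let_def split: if_splits)
    have k: "even k"
    proof (rule ccontr)
      assume o: "odd k"
      with v have "real_of_int (2 * (x - x')) = of_int (dx k)"
        by (simp add: vert_def dvec_def complex_eq_iff)
      then have "2 * (x - x') = dx k" by (simp only: of_int_eq_iff)
      then show False using odd_d[OF o] by presburger
    qed
    with v have "vert x y = vert (x' + dx k) (y' + dy k)" by (simp add: vert_add_d)
    then have "\<alpha> = arrow_at x y (k + 4)" using arrow_at_reverse[OF k] that(2) by simp
    then show ?thesis by blast
  qed
  have 2: "tail (arrow_at x y k) = vert x y \<or> head (arrow_at x y k) = vert x y" for k
    by (simp add: arrow_at_def Let_def)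
  have "crossing tiles (vert x y) = range (arrow_at x y)"
  proof (intro subset_antisym subsetI)
    fix \<alpha> assume "\<alpha> \<in> crossing tiles (vert x y)"
    note \<alpha> = this[unfolded crossing_def all_arrows, THEN CollectD]
    from conjunct1[OF \<alpha>] obtain x' y' k where "\<alpha> = arrow_at x' y' k" by blast
    with conjunct2[OF \<alpha>] show "\<alpha> \<in> range (arrow_at x y)" by (rule 1)
  next
    fix \<alpha> assume "\<alpha> \<in> range (arrow_at x y)"
    then obtain k where k: "\<alpha> = arrow_at x y k" by blast
    then have "\<alpha> \<in> {arrow_at x y k | x y k. True}" by blast
    then show "\<alpha> \<in> crossing tiles (vert x y)"
      unfolding crossing_def all_arrows using 2 k by (intro CollectI conjI) simp_all
  qed
  also have "\<dots> = arrow_at x y ` {..<8}"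
  proof (intro subset_antisym subsetI)
    fix \<alpha> assume "\<alpha> \<in> range (arrow_at x y)"
    then obtain k where k: "\<alpha> = arrow_at x y k" by blast
    have "\<alpha> = arrow_at x y (k mod 8)" unfolding k by (rule arrow_at_cong) simp
    then show "\<alpha> \<in> arrow_at x y ` {..<8}" by (intro image_eqI) auto
  qed auto
  finally show ?thesis .
qed

lemma arrow_at_status:
  "if fst (X x y k) then leaves (vert x y) (dir k) (arrow_at x y k) else enters (vert x y) (dir k) (arrow_at x y k)"
  "hue (arrow_at x y k) = snd (X x y k)"
  by (simp_all add: arrow_at_def leaves_def enters_def Let_def sgn_dvec sgn_mult sgn_of_real)

lemma legal_crossing_tiles: "legal_crossing (vert x y) (crossing tiles (vert x y))"
proof -
  obtain m where m: "legal_at (X x y) m" using legal by blast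
  have "arrow_at x y ` {..<8} = (\<lambda>k. arrow_at x y (m + k)) ` {..<8}"
  proof (intro subset_antisym subsetI)
    fix \<alpha> assume "\<alpha> \<in> arrow_at x y ` {..<8}"
    then obtain k where k: "\<alpha> = arrow_at x y k" by blast
    \<comment> \<open>\<open>k + 7 * m\<close> stands for \<open>k - m\<close> modulo
      \<open>8\<close>: the numbering is moved to start at the outgoing axis.\<close>
    have "m + (k + 7 * m) = k + 8 * m" by simp
    then have "(m + (k + 7 * m) mod 8) mod 8 = k mod 8" by (simp only: mod_add_right_eq mod_mult_self2)
    then have "\<alpha> = arrow_at x y (m + (k + 7 * m) mod 8)" unfolding k by (intro arrow_at_cong) simp
    then show "\<alpha> \<in> (\<lambda>k. arrow_at x y (m + k)) ` {..<8}" by (intro image_eqI) auto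
  next
    fix \<alpha> assume "\<alpha> \<in> (\<lambda>k. arrow_at x y (m + k)) ` {..<8}"
    then obtain k where k: "\<alpha> = arrow_at x y (m + k)" by blast
    have "\<alpha> = arrow_at x y ((m + k) mod 8)" unfolding k by (rule arrow_at_cong) simp
    then show "\<alpha> \<in> arrow_at x y ` {..<8}" by (intro image_eqI) auto
  qed
  note A = crossing_tiles[of x y, unfolded this]
  have lv: "leaves (vert x y) (dir (m + k)) (arrow_at x y (m + k))" if "fst (X x y (m + k))" for k
    using arrow_at_status(1)[of x y "m + k"] that by simp
  have en: "enters (vert x y) (dir (m + k)) (arrow_at x y (m + k))" if "\<not> fst (X x y (m + k))" for k
    using arrow_at_status(1)[of x y "m + k"] that by simp
  note L = m[unfolded legal_at_def]
  show ?thesis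
    unfolding legal_crossing_def
  proof (intro exI conjI)
    show "norm (dir m) = 1" by simp
    show "\<forall>k. dir (m + k) = dir m * cis (real k * pi / 4)"
      by (simp add: dir_add) (simp add: dir_def)
    show "crossing tiles (vert x y) = (\<lambda>k. arrow_at x y (m + k)) ` {..<8}" by (rule A)
    show "leaves (vert x y) (dir (m + 0)) (arrow_at x y (m + 0))" using L by (intro lv) simp
    show "enters (vert x y) (dir (m + 4)) (arrow_at x y (m + 4))" using L by (intro en) simp
    show "enters (vert x y) (dir (m + 2)) (arrow_at x y (m + 2))" using L by (intro en) simp
    show "enters (vert x y) (dir (m + 6)) (arrow_at x y (m + 6))" using L by (intro en) simp
    show "hue (arrow_at x y (m + 0)) = hue (arrow_at x y (m + 4))"
      "hue (arrow_at x y (m + 2)) \<noteq> hue (arrow_at x y (m + 6))"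
      using L by (simp_all add: arrow_at_status)
    show "\<forall>k\<in>{1, 3, 5, 7}. leaves (vert x y) (dir (m + k)) (arrow_at x y (m + k))"
      using L by (intro ballI lv) auto
    show "\<forall>k\<in>{2, 6}. hue (arrow_at x y (m + (k - 1))) = Red \<and> hue (arrow_at x y (m + (k + 1))) = Green"
    proof -
      have "m + (2 - 1) = m + 1" "m + (2 + 1) = m + 3" "m + (6 - 1) = m + 5" "m + (6 + 1) = m + 7"
        by simp_all
      moreover have "snd (X x y (m + 1)) = Red" "snd (X x y (m + 3)) = Green"
        "snd (X x y (m + 5)) = Red" "snd (X x y (m + 7)) = Green" using L by simp_all
      ultimately show ?thesis by (simp only: ball_simps arrow_at_status simp_thms)
    qed
  qed
qed

lemma square_tile_at: "square_tile (tile_at x y)"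
proof -
  define a where "a = origin x y"
  have o: "odd (x + y + int (a + 1))" using origin_parity[of x y] by (simp add: a_def)
  have e: "a + 1 + 2 = a + 3" by simp
  show ?thesis
    unfolding square_tile_def
  proof (intro exI conjI)
    show "center (tile_at x y) = ctr x y"
      "sides (tile_at x y) = (\<lambda>j. arrow_at (cx x j) (cy y j) (2 * j + 4)) ` {..<4}"
      "axis (tile_at x y) = Arrow (corner (ctr x y) a) (corner (ctr x y) (a + 2)) (snd (spoke x y a))"
      "half_diagonals (tile_at x y) =
        {Arrow (corner (ctr x y) (a + 1)) (ctr x y) (snd (spoke x y (a + 1))),
         Arrow (corner (ctr x y) (a + 3)) (ctr x y) (snd (spoke x y (a + 3)))}"
      "triangles (tile_at x y) =
        (\<lambda>j. (triangle (ctr x y) j, if even (j + a) then Red else Green)) ` {a..<a + 4}"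
      unfolding a_def by (rule tile_at_sel)+
    show "snd (spoke x y (a + 1)) \<noteq> snd (spoke x y (a + 3))"
      using spoke_hue[OF o] unfolding e by simp
    show "\<forall>j\<in>{a + 1, a + 3}. (if even (j - 1 + a) then Red else Green) = Red \<and>
      (if even (j + a) then Red else Green) = Green" by auto
    show "\<forall>j<4. (tail (arrow_at (cx x j) (cy y j) (2 * j + 4)), head (arrow_at (cx x j) (cy y j) (2 * j + 4))) \<in>
      {(corner (ctr x y) j, corner (ctr x y) (Suc j)), (corner (ctr x y) (Suc j), corner (ctr x y) j)}"
      by (simp add: arrow_at_def Let_def vert_corner corner_Suc)
  qed
qed

lemma correct_tiles: "correct_tiling tiles"
  unfolding correct_tiling_def
proof (intro conjI)
  show "tiles_plane tiles"
    unfolding tiles_plane_def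
  proof (intro conjI ballI impI)
    show "square_tile t" if "t \<in> tiles" for t using that square_tile_at by (auto simp: tiles_def)
    have "p \<in> square (ctr \<lfloor>Re p\<rfloor> \<lfloor>Im p\<rfloor>)" for p
      unfolding in_square ctr_def abs_le_iff using floor_correct[of "Re p"] floor_correct[of "Im p"]
      by (intro conjI; simp; linarith)
    then have "p \<in> (\<Union>t\<in>tiles. square (center t))" for p
      by (intro UN_I[OF tile_at_in_tiles[of "\<lfloor>Re p\<rfloor>" "\<lfloor>Im p\<rfloor>"]])
        (simp only: tile_at_sel)
    then show "(\<Union>t\<in>tiles. square (center t)) = UNIV" by (intro UNIV_eq_I[symmetric])
    fix t t' assume "t \<in> tiles" "t' \<in> tiles" "t \<noteq> t'"
    then obtain x y x' y' where t: "t = tile_at x y" "t' = tile_at x' y'" "\<not> (x = x' \<and> y = y')"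
      unfolding tiles_def by blast
    show "interior (square (center t)) \<inter> interior (square (center t')) = {}"
    proof (rule ccontr)
      assume "interior (square (center t)) \<inter> interior (square (center t')) \<noteq> {}"
      then obtain p where "p \<in> interior (square (ctr x y))" "p \<in> interior (square (ctr x' y'))"
        unfolding t tile_at_sel by blast
      then have "\<bar>real_of_int x - real_of_int x'\<bar> < 1"
        "\<bar>real_of_int y - real_of_int y'\<bar> < 1"
        unfolding in_square_interior abs_less_iff by (auto simp: ctr_def)
      then have "x = x' \<and> y = y'" by linarith
      with t(3) show False ..
    qed
  qed
  show "edge_to_edge tiles"
    unfolding edge_to_edge_def Let_def
  proof (intro ballI impI)
    fix t t' assume "t \<in> tiles" "t' \<in> tiles" "t \<noteq> t'"
    then obtain x y x' y' where t: "t = tile_at x y" "t' = tile_at x' y'" "\<not> (x = x' \<and> y = y')"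
      unfolding tiles_def by blast
    have "ctr x' y' = ctr x y + Complex (of_int (x' - x)) (of_int (y' - y))"
      by (simp add: ctr_def complex_eq_iff)
    moreover have "\<not> (x' - x = 0 \<and> y' - y = 0)" using t(3) by auto
    ultimately show "square (center t) \<inter> square (center t') = {} \<or>
        (\<exists>j k. square (center t) \<inter> square (center t') = {corner (center t) j} \<and>
           square (center t) \<inter> square (center t') = {corner (center t') k}) \<or>
        (\<exists>j k. square (center t) \<inter> square (center t') = edge (center t) j \<and>
           square (center t) \<inter> square (center t') = edge (center t') k)"
      unfolding t tile_at_sel by (rule squares_meet)
  qed
  show "\<forall>t\<in>tiles. \<forall>t'\<in>tiles. \<forall>\<alpha>\<in>sides t. \<forall>\<beta>\<in>sides t'. support \<alpha> = support \<beta> \<longrightarrow> \<alpha> = \<beta>"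
  proof (intro ballI impI)
    fix t t' \<alpha> \<beta>
    assume "t \<in> tiles"
      "t' \<in> tiles"
      "\<alpha> \<in> sides t"
      "\<beta> \<in> sides t'" and s: "support \<alpha> = support \<beta>"
    have side: "\<exists>x y k. even k \<and> \<gamma> = arrow_at x y k" if "u \<in> tiles"
      "\<gamma> \<in> sides u" for u \<gamma>
    proof -
      from that obtain x y j where "\<gamma> = arrow_at (cx x j) (cy y j) (2 * j + 4)"
        unfolding tiles_def by (auto simp: tile_at_sel)
      moreover have "even (2 * j + 4)" by simp
      ultimately show ?thesis by blast
    qed
    obtain x y k where k: "even k" "\<alpha> = arrow_at x y k"
      using side[OF \<open>t \<in> tiles\<close> \<open>\<alpha> \<in> sides t\<close>] by blast
    obtain x' y' l where l: "even l" "\<beta> = arrow_at x' y' l"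
      using side[OF \<open>t' \<in> tiles\<close> \<open>\<beta> \<in> sides t'\<close>] by blast
    have "support (arrow_at x y k) = closed_segment (vert x y) (vert x y + dvec k)" if "even k" for x y k
      using that by (simp add: support_def arrow_at_def Let_def insert_commute)
    \<comment> \<open>A segment determines its pair of endpoints, so two sides with equal supports
      agree either in vertex and direction or after reversal.\<close>
    with k l s have "{vert x y, vert x y + dvec k} = {vert x' y', vert x' y' + dvec l}" by simp
    then consider "vert x y = vert x' y'" "dvec k = dvec l"
      | "vert x y = vert (x' + dx l) (y' + dy l)" "dvec k = - dvec l"
      by (auto simp: doubleton_eq_iff vert_add_d eq_neg_iff_add_eq_0 add.commute)
    then show "\<alpha> = \<beta>"
    proof cases
      case 1
      then show ?thesis using k l arrow_at_cong[of k l] by (simp add: dvec_eq_iff)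
    next
      case 2
      then have "dvec k = dvec (l + 4)" by (simp only: dvec_add_4)
      then have "arrow_at x y k = arrow_at x y (l + 4)" unfolding dvec_eq_iff by (rule arrow_at_cong)
      then show ?thesis using 2(1) k l arrow_at_reverse[OF l(1), of x' y'] by simp
    qed
  qed
  show "\<forall>t\<in>tiles. \<forall>t'\<in>tiles. \<forall>(A, c)\<in>triangles t. \<forall>(B, d)\<in>triangles t'.
       A \<noteq> B \<and> (\<exists>p q. p \<noteq> q \<and> {p, q} \<subseteq> A \<inter> B) \<longrightarrow> c \<noteq> d"
  proof (intro ballI, clarify)
    fix t t' A c B d p q
    assume "t \<in> tiles"
      "t' \<in> tiles" and A: "(A, c) \<in> triangles t" and B: "(B, c) \<in> triangles t'"
      and pq: "A \<noteq> B" "p \<noteq> q" "{p, q} \<subseteq> A \<inter> B"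
    obtain x y j where j: "A = triangle (ctr x y) j" "c = (if even (x + y + int j) then Red else Green)"
      using A \<open>t \<in> tiles\<close> origin_parity unfolding tiles_def by (auto simp: tile_at_sel)
    obtain x' y' k where k: "B = triangle (ctr x' y') k"
      "c = (if even (x' + y' + int k) then Red else Green)"
      using B \<open>t' \<in> tiles\<close> origin_parity unfolding tiles_def by (auto simp: tile_at_sel)
    have "even (x + y + int j) \<longleftrightarrow> odd (x' + y' + int k)"
      using triangle_color[OF pq[unfolded j(1) k(1)]] .
    with j(2) k(2) show False by (auto split: if_splits)
  qed
  show "\<forall>t\<in>tiles. \<forall>j. legal_crossing (corner (center t) j) (crossing tiles (corner (center t) j))"
    using legal_crossing_tiles by (auto simp: tiles_def tile_at_sel simp flip: vert_corner)
qed

end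

theorem theorem1:
  "(\<exists>T. correct_tiling T) \<and> (\<forall>T. correct_tiling T \<longrightarrow> \<not> periodic T)"
proof (intro conjI allI impI)
  interpret pattern "arrows 0"
    using coherent_arrows by (rule pattern.intro)
  show "\<exists>T. correct_tiling T" using correct_tiles by blast
  show "\<not> periodic T" if "correct_tiling T" for T
    by (rule tiling.aperiodic[OF tiling.intro[OF that]])
qed

end
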